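(* Let $H$ be a wheel. Then every graph with tree-width at least $\max\{\frac{3}{2}|V(H)|-\frac{9}{2},\,|V(H)|-1\}$ contains $H$ as a minor. In other words, $f(H)\leq \max\{\frac{3}{2}|V(H)|-\frac{9}{2},\,|V(H)|-1\}$, and if $|V(H)|\leq 7$, then $f(H)=|V(H)|-1$.
   Context: All graphs are finite and simple. For an integer $k\geq 3$, the $k$-wheel is the graph obtained from a cycle of length $k$ by adding a new vertex adjacent to all vertices of the cycle; a wheel is a $k$-wheel for some integer $k\ge 3$ (so a $k$-wheel has $k+1$ vertices, and $K_4$ is a wheel). A tree-decomposition of a graph $G$ is a pair $(T,\mathcal{X})$ where $T$ is a (non-empty) tree and $\mathcal{X}=(X_t : t\in V(T))$ is a collection of sets (called bags) such that: (i) $\bigcup_{t\in V(T)}X_t=V(G)$; (ii) for every $e\in E(G)$ there exists $t\in V(T)$ such that $X_t$ contains both ends of $e$; (iii) for every $v\in V(G)$, the set $\{t\in V(T): v\in X_t\}$ induces a connected subgraph of $T$. The width of $(T,\mathcal{X})$ is $\max_{t\in V(T)}|X_t|-1$. The tree-width of $G$ is the minimum width of a tree-decomposition of $G$. A graph $G$ contains a graph $H$ as a minor if a graph isomorphic to $H$ can be obtained from $G$ by a sequence of vertex deletions, edge deletions, and edge contractions. For a planar graph $H$, $f(H)$ denotes the smallest integer such that every graph with tree-width at least $f(H)$ contains $H$ as a minor. *)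

theory Defs
  imports Complex_Main "Graph_Theory.Graph_Theory"
begin

text \<open>
  A finite simple graph is a \<^locale>\<open>pair_graph\<close>: a finite, loop-free digraph with a symmetric arc
  relation, so an edge between \<open>u\<close> and \<open>v\<close> is the pair of arcs \<open>(u, v)\<close>, \<open>(v, u)\<close>.
\<close>

definition cycle_graph :: "nat \<Rightarrow> nat pair_pre_digraph" where
  "cycle_graph k = \<lparr> pverts = {..<k},
     parcs = (\<Union>i<k. {(i, (i + 1) mod k), ((i + 1) mod k, i)}) \<rparr>"

definition wheel_graph :: "nat \<Rightarrow> nat pair_pre_digraph" where
  "wheel_graph k = \<lparr> pverts = insert k (pverts (cycle_graph k)),
     parcs = parcs (cycle_graph k) \<union> (\<Union>v\<in>pverts (cycle_graph k). {(k, v), (v, k)}) \<rparr>"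

definition is_wheel :: "'a pair_pre_digraph \<Rightarrow> bool" where
  "is_wheel H \<longleftrightarrow> (\<exists>k\<ge>3. digraph_iso (wheel_graph k) H)"

text \<open>
  The constant \<open>tree\<close> of the library is not usable for symmetric digraphs, because traversing an edge
  back and forth is a cycle in the sense of \<^const>\<open>pre_digraph.cycle\<close>; an undirected cycle is one of
  length at least 3.  A connected digraph is nonempty in the library.
\<close>

definition is_tree :: "'t pair_pre_digraph \<Rightarrow> bool" where
  "is_tree T \<longleftrightarrow> pair_graph T \<and> Digraph_Component.connected T \<and>
     \<not> (\<exists>p. pre_digraph.cycle T p \<and> 3 \<le> length p)"

definition tree_decomposition ::
    "'a pair_pre_digraph \<Rightarrow> 't pair_pre_digraph \<Rightarrow> ('t \<Rightarrow> 'a set) \<Rightarrow> bool" where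
  "tree_decomposition G T X \<longleftrightarrow> is_tree T \<and>
     (\<Union>t\<in>pverts T. X t) = pverts G \<and>
     (\<forall>(u, v)\<in>parcs G. \<exists>t\<in>pverts T. u \<in> X t \<and> v \<in> X t) \<and>
     (\<forall>v\<in>pverts G. Digraph_Component.connected (T \<restriction> {t \<in> pverts T. v \<in> X t}))"

definition width :: "'t pair_pre_digraph \<Rightarrow> ('t \<Rightarrow> 'a set) \<Rightarrow> int" where
  "width T X = Max ((\<lambda>t. int (card (X t))) ` pverts T) - 1"

text \<open>
  Decomposition trees are finite, so it is no restriction to take their vertices in \<^typ>\<open>nat\<close>.
  The width is an integer because the graph without vertices has tree-width \<open>-1\<close>.
\<close>

definition treewidth :: "'a pair_pre_digraph \<Rightarrow> int" where
  "treewidth G = (LEAST w. \<exists>(T :: nat pair_pre_digraph) X. tree_decomposition G T X \<and> width T X = w)"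

text \<open>
  Contracting the edge \<open>uv\<close> keeps the name \<open>u\<close> for the merged vertex.  Parallel edges are merged since
  the arcs form a set.
\<close>

inductive minor_step :: "'a pair_pre_digraph \<Rightarrow> 'a pair_pre_digraph \<Rightarrow> bool" where
  delete_vertex: "v \<in> pverts G \<Longrightarrow>
    minor_step G \<lparr> pverts = pverts G - {v}, parcs = {(x, y) \<in> parcs G. x \<noteq> v \<and> y \<noteq> v} \<rparr>"
| delete_edge: "(u, v) \<in> parcs G \<Longrightarrow>
    minor_step G \<lparr> pverts = pverts G, parcs = parcs G - {(u, v), (v, u)} \<rparr>"
| contract_edge: "(u, v) \<in> parcs G \<Longrightarrow>
    minor_step G \<lparr> pverts = pverts G - {v},
      parcs = map_prod (id(v := u)) (id(v := u)) ` (parcs G - {(u, v), (v, u)}) \<rparr>"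

definition has_minor :: "'a pair_pre_digraph \<Rightarrow> 'b pair_pre_digraph \<Rightarrow> bool" where
  "has_minor G H \<longleftrightarrow> (\<exists>K. minor_step\<^sup>*\<^sup>* G K \<and> digraph_iso K H)"

text \<open>
  Every finite graph is isomorphic to one with vertices in \<^typ>\<open>nat\<close>, so quantifying over these covers
  all graphs.  The value is meaningful only for nonempty planar \<open>H\<close>, where the least integer exists.
\<close>

definition minor_threshold :: "'b pair_pre_digraph \<Rightarrow> int" where
  "minor_threshold H =
     (LEAST n. \<forall>G :: nat pair_pre_digraph. pair_graph G \<and> n \<le> treewidth G \<longrightarrow> has_minor G H)"

end

theory Submission
  imports Defs
begin

text \<open>
  Let \<open>M\<close> be the larger of \<open>k\<close> and the integer part of \<open>3 * k / 2 - 3\<close>, and let \<open>G\<close> have no \<open>k\<close>-wheel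
  minor.  Consider connected sets \<open>D\<close> whose neighbourhood \<open>X\<close> is carried by a cycle of disjoint
  connected branch sets outside \<open>D\<close>, one for each vertex of \<open>X\<close>; then \<open>card X < k\<close>, since otherwise
  \<open>D\<close> is the hub of a \<open>k\<close>-wheel.  By induction on \<open>D\<close>, the set \<open>D\<close> can be decomposed below the bag \<open>X\<close>
  with bags of at most \<open>M\<close> vertices.  Choose a path \<open>R\<close> in \<open>D\<close> joining neighbours of two consecutive
  vertices of the cycle, and a component \<open>H\<close> of \<open>D - R\<close>, with \<open>H\<close> as large as possible.  Inserting \<open>R\<close>
  into the cycle shows that \<open>H\<close> is again such a set, so it has fewer than \<open>k\<close> neighbours.
  Maximality of \<open>H\<close> forces every \<open>x\<close> in \<open>X\<close> without a neighbour in \<open>H\<close> to lie between two cycle vertices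
  all of whose neighbours in \<open>D\<close> are in \<open>H\<close>, so if there are any such \<open>x\<close>, they number at most
  \<open>(k - 4) / 2\<close>.  Hence the bag consisting of \<open>X\<close> and the neighbours of \<open>H\<close> on \<open>R\<close> has at most \<open>M\<close>
  vertices, and rerouting \<open>R\<close> through \<open>H\<close> handles the remaining components.  The complete graph on
  \<open>k\<close> vertices gives the lower bound for the threshold.
\<close>

section \<open>Connected sets and components\<close>

text \<open>Connectivity is phrased for a bare arc relation, so that many vertex sets of one graph
  can be handled without forming subgraphs. Nonemptiness is built in because branch sets must be
  nonempty.\<close>

definition conn :: "'a rel \<Rightarrow> 'a set \<Rightarrow> bool" where
  "conn E A \<longleftrightarrow> A \<noteq> {} \<and> (\<forall>u\<in>A. \<forall>v\<in>A. (u, v) \<in> (Restr E A)\<^sup>*)"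

definition nbh :: "'a rel \<Rightarrow> 'a set \<Rightarrow> 'a set" where
  "nbh E A = {x. x \<notin> A \<and> (\<exists>d\<in>A. (d, x) \<in> E)}"

definition is_comp :: "'a rel \<Rightarrow> 'a set \<Rightarrow> 'a set \<Rightarrow> bool" where
  "is_comp E A C \<longleftrightarrow> conn E C \<and> C \<subseteq> A \<and> nbh E C \<inter> A = {}"

lemma conn_nonempty: "conn E A \<Longrightarrow> A \<noteq> {}"
  by (simp add: conn_def)

lemma conn_singleton [simp]: "conn E {v}"
  by (simp add: conn_def)

lemma Restr_rtrancl_mono: "A \<subseteq> B \<Longrightarrow> (u, v) \<in> (Restr E A)\<^sup>* \<Longrightarrow> (u, v) \<in> (Restr E B)\<^sup>*"
  by (rule subsetD[OF rtrancl_mono]) auto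

lemma Restr_rtrancl_sym:
  assumes "sym E" "(u, v) \<in> (Restr E A)\<^sup>*"
  shows "(v, u) \<in> (Restr E A)\<^sup>*"
proof -
  have "sym (Restr E A)" using assms(1) by (auto simp: sym_def)
  then show ?thesis using assms(2) by (metis sym_rtrancl symD)
qed

lemma conn_hub:
  assumes "sym E" and "r \<in> A" and "\<And>u. u \<in> A \<Longrightarrow> (r, u) \<in> (Restr E A)\<^sup>*"
  shows "conn E A"
  unfolding conn_def
  using assms Restr_rtrancl_sym[OF assms(1)] by (blast intro: rtrancl_trans)

lemma conn_Un:
  assumes "sym E" "conn E A" "conn E B" "A \<inter> B \<noteq> {}"
  shows "conn E (A \<union> B)"
proof -
  obtain r where r: "r \<in> A" "r \<in> B" using assms(4) by auto
  show ?thesis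
  proof (rule conn_hub[OF assms(1), of r])
    fix u assume "u \<in> A \<union> B"
    then have "(r, u) \<in> (Restr E A)\<^sup>* \<or> (r, u) \<in> (Restr E B)\<^sup>*"
      using r assms(2,3) by (auto simp: conn_def)
    then show "(r, u) \<in> (Restr E (A \<union> B))\<^sup>*"
      using Restr_rtrancl_mono[of A "A \<union> B"] Restr_rtrancl_mono[of B "A \<union> B"] by blast
  qed (use r in auto)
qed

lemma conn_edge:
  assumes "sym E" "(u, v) \<in> E"
  shows "conn E {u, v}"
  by (rule conn_hub[OF assms(1), of u]) (use assms in auto)

lemma conn_Un_edge:
  assumes "sym E" "conn E A" "conn E B" "a \<in> A" "b \<in> B" "(a, b) \<in> E"
  shows "conn E (A \<union> B)"
proof -
  have "conn E (A \<union> {a, b})" using assms conn_Un conn_edge by fastforce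
  then have "conn E (A \<union> {a, b} \<union> B)" using assms conn_Un by fastforce
  moreover have "A \<union> {a, b} \<union> B = A \<union> B" using assms by auto
  ultimately show ?thesis by simp
qed

text \<open>A walk inside \<open>B\<close> from a vertex of \<open>C\<close> to a vertex outside
  \<open>C\<close> has to cross the boundary. Adjacencies between two parts of a connected set are
  found this way below.\<close>

lemma conn_exit:
  assumes "conn E B" "B \<inter> C \<noteq> {}" "\<not> B \<subseteq> C"
  obtains u v where "u \<in> B" "u \<in> C" "v \<in> B" "v \<notin> C" "(u, v) \<in> E"
proof -
  obtain p q where p: "p \<in> B" "p \<in> C" and q: "q \<in> B" "q \<notin> C" using assms(2,3) by auto
  have "(p, q) \<in> (Restr E B)\<^sup>*" using assms(1) p q by (auto simp: conn_def)
  then have "\<exists>u v. u \<in> B \<and> u \<in> C \<and> v \<in> B \<and> v \<notin> C \<and> (u, v) \<in> E" using q(2)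
  proof (induction rule: rtrancl_induct)
    case base then show ?case using p by auto
  next
    case (step y z) then show ?case by (cases "y \<in> C") auto
  qed
  then show thesis using that by blast
qed

text \<open>The set \<open>R\<close> serves as a core: each vertex of \<open>B\<close> reaches it
  inside some connected piece that meets \<open>R\<close>.\<close>

lemma conn_family:
  assumes "sym E" "conn E R" "R \<subseteq> B"
    and "\<And>u. u \<in> B \<Longrightarrow> \<exists>C. u \<in> C \<and> C \<subseteq> B \<and> conn E C \<and> C \<inter> R \<noteq> {}"
  shows "conn E B"
proof -
  obtain r where r: "r \<in> R" using conn_nonempty[OF assms(2)] by auto
  show ?thesis
  proof (rule conn_hub[OF assms(1), of r])
    show "r \<in> B" using r assms(3) by auto
    fix u assume "u \<in> B"
    from assms(4)[OF this] obtain C where C: "u \<in> C" "C \<subseteq> B" "conn E C" "C \<inter> R \<noteq> {}" by blast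
    have "conn E (C \<union> R)" using conn_Un[OF assms(1) C(3) assms(2) C(4)] .
    then have "(r, u) \<in> (Restr E (C \<union> R))\<^sup>*" using r C by (auto simp: conn_def)
    then show "(r, u) \<in> (Restr E B)\<^sup>*" by (rule Restr_rtrancl_mono[rotated]) (use C assms(3) in auto)
  qed
qed

lemma is_comp_conn: "is_comp E A C \<Longrightarrow> conn E C"
  and is_comp_subset: "is_comp E A C \<Longrightarrow> C \<subseteq> A"
  and is_comp_nbh: "is_comp E A C \<Longrightarrow> nbh E C \<inter> A = {}"
  by (auto simp: is_comp_def)

lemma comp_exists:
  assumes "sym E" "u \<in> A"
  obtains C where "is_comp E A C" "u \<in> C"
proof -
  define C where "C = {v \<in> A. (u, v) \<in> (Restr E A)\<^sup>*}"
  have inC: "(u, v) \<in> (Restr E C)\<^sup>*" if "(u, v) \<in> (Restr E A)\<^sup>*" for v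
    using that
  proof (induction rule: rtrancl_induct)
    case (step y z)
    then have "y \<in> C" "z \<in> C" by (auto simp: C_def intro: rtrancl_into_rtrancl)
    then show ?case using step by (meson IntI SigmaI Int_iff rtrancl.rtrancl_into_rtrancl)
  qed auto
  have u: "u \<in> C" using assms by (simp add: C_def)
  have "conn E C"
    by (rule conn_hub[OF assms(1) u]) (use inC in \<open>auto simp: C_def\<close>)
  moreover have "nbh E C \<inter> A = {}"
    unfolding nbh_def C_def by (auto intro: rtrancl_into_rtrancl)
  ultimately have "is_comp E A C" by (auto simp: is_comp_def C_def)
  then show thesis using that u by blast
qed

lemma conn_subset_comp:
  assumes "is_comp E A C" "conn E B" "B \<subseteq> A" "B \<inter> C \<noteq> {}"
  shows "B \<subseteq> C"
proof (rule ccontr)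
  assume "\<not> B \<subseteq> C"
  then obtain u v where "u \<in> C" "v \<in> B" "v \<notin> C" "(u, v) \<in> E"
    using conn_exit[OF assms(2,4)] by metis
  then have "v \<in> nbh E C \<inter> A" using assms(3) by (auto simp: nbh_def)
  then show False using assms(1) by (auto simp: is_comp_def)
qed

lemma comp_exists_conn:
  assumes "sym E" "conn E B" "B \<subseteq> A"
  obtains C where "is_comp E A C" "B \<subseteq> C"
proof -
  obtain b where b: "b \<in> B" using conn_nonempty[OF assms(2)] by auto
  then obtain C where "is_comp E A C" "b \<in> C" using comp_exists assms by (metis subsetD)
  then show thesis using that conn_subset_comp[OF _ assms(2,3)] b by blast
qed

lemma comp_disjoint:
  assumes "is_comp E A C" "is_comp E A C'" "C \<noteq> C'"
  shows "C \<inter> C' = {}"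
  using assms conn_subset_comp[of E A] by (metis Int_commute is_comp_def subset_antisym)

lemma comp_nbh_Diff:
  assumes "is_comp E (D - S) C"
  shows "nbh E C \<subseteq> nbh E D \<union> S"
  using assms by (auto simp: is_comp_def nbh_def)

text \<open>Every component of \<open>D - R\<close> other than \<open>H\<close> is attached to \<open>R\<close>.\<close>

lemma conn_Diff_comp:
  assumes "sym E" "conn E D" "conn E R" "R \<subseteq> D" "is_comp E (D - R) H"
  shows "conn E (D - H)"
proof (rule conn_family[OF assms(1,3)])
  show "R \<subseteq> D - H" using assms by (auto simp: is_comp_def)
  fix u assume u: "u \<in> D - H"
  show "\<exists>C. u \<in> C \<and> C \<subseteq> D - H \<and> conn E C \<and> C \<inter> R \<noteq> {}"
  proof (cases "u \<in> R")
    case True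
    then show ?thesis using u by (intro exI[of _ "{u}"]) auto
  next
    case False
    then obtain C where C: "is_comp E (D - R) C" "u \<in> C"
      using comp_exists[OF assms(1), of u "D - R"] u by blast
    have "\<not> D \<subseteq> C" "D \<inter> C \<noteq> {}"
      using C u conn_nonempty[OF assms(3)] assms(4) by (auto simp: is_comp_def)
    \<comment> \<open>An arc leaves \<open>C\<close> within \<open>D\<close>; since \<open>C\<close>
      is a component of \<open>D - R\<close>, it can only end in \<open>R\<close>.\<close>
    then obtain p q where pq: "p \<in> C" "q \<in> D" "q \<notin> C" "(p, q) \<in> E"
      using conn_exit[OF assms(2)] by metis
    then have "q \<in> R" using C(1) by (auto simp: is_comp_def nbh_def)
    moreover have "q \<notin> H" using \<open>q \<in> R\<close> assms(5) by (auto simp: is_comp_def)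
    moreover have "C \<inter> H = {}" using comp_disjoint[OF C(1) assms(5)] C(2) u by blast
    moreover have "conn E (C \<union> {q})"
      using conn_Un_edge[OF assms(1) is_comp_conn[OF C(1)] conn_singleton pq(1) _ pq(4)] by simp
    ultimately show ?thesis
      using C pq(2) by (intro exI[of _ "C \<union> {q}"]) (auto simp: is_comp_def)
  qed
qed

section \<open>Paths\<close>

definition gpath :: "'a rel \<Rightarrow> 'a list \<Rightarrow> bool" where
  "gpath E R \<longleftrightarrow> R \<noteq> [] \<and> distinct R \<and> successively (\<lambda>x y. (x, y) \<in> E) R"

lemma successively_conn:
  assumes "sym E" "R \<noteq> []" "successively (\<lambda>x y. (x, y) \<in> E) R"
  shows "conn E (set R)"
  using assms(2,3)
proof (induction R rule: induct_list012)
  case (3 x y zs)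
  then have "conn E ({x} \<union> set (y # zs))"
    by (intro conn_Un_edge[OF assms(1), of "{x}" _ x y]) auto
  then show ?case by (simp add: insert_commute)
qed auto

lemma gpath_conn: "sym E \<Longrightarrow> gpath E R \<Longrightarrow> conn E (set R)"
  by (simp add: gpath_def successively_conn)

lemma walk_conn_exists:
  assumes "(u, v) \<in> (Restr E A)\<^sup>*" "u \<in> A"
  shows "\<exists>R. gpath E R \<and> set R \<subseteq> A \<and> hd R = u \<and> last R = v"
  using assms(1)
proof (induction rule: rtrancl_induct)
  case base
  then show ?case using assms(2) by (intro exI[of _ "[u]"]) (auto simp: gpath_def)
next
  case (step y z)
  then obtain R where R: "gpath E R" "set R \<subseteq> A" "hd R = u" "last R = y" by blast
  show ?case
  \<comment> \<open>If the walk returns to the path, the path is cut back to \<open>z\<close>, which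
    keeps it simple.\<close>
  proof (cases "z \<in> set R")
    case True
    then obtain P Q where PQ: "R = P @ z # Q" by (meson split_list)
    then have "gpath E (P @ [z])" "hd (P @ [z]) = u"
      using R by (auto simp: gpath_def successively_append_iff successively_Cons hd_append split: if_splits)
    then show ?thesis using R PQ by (intro exI[of _ "P @ [z]"]) auto
  next
    case False
    then have "gpath E (R @ [z])" using R step
      by (auto simp: gpath_def successively_append_iff)
    then show ?thesis using R step by (intro exI[of _ "R @ [z]"]) (auto simp: gpath_def)
  qed
qed

lemma conn_gpath:
  assumes "conn E A" "u \<in> A" "v \<in> A"
  obtains R where "gpath E R" "set R \<subseteq> A" "hd R = u" "last R = v"
  using walk_conn_exists[of u v E A] assms by (auto simp: conn_def)

section \<open>Cyclic states\<close>

text \<open>Adjacency of branch sets. The disjunct \<open>x = y\<close> makes every list of length 1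
  satisfy \<open>cyc (touch E f)\<close>, as degenerate cycles require.\<close>

definition touch :: "'a rel \<Rightarrow> ('a \<Rightarrow> 'a set) \<Rightarrow> 'a \<Rightarrow> 'a \<Rightarrow> bool" where
  "touch E f x y \<longleftrightarrow> x = y \<or> (\<exists>u\<in>f x. \<exists>v\<in>f y. (u, v) \<in> E)"

definition cyc :: "('a \<Rightarrow> 'a \<Rightarrow> bool) \<Rightarrow> 'a list \<Rightarrow> bool" where
  "cyc P xs \<longleftrightarrow> xs = [] \<or> successively P (xs @ [hd xs])"

text \<open>
  The list gives the cyclic order of the branch sets \<open>f y\<close> of a cycle minor outside \<open>D\<close>.  The cycle
  may be degenerate: lists of length 0, 1 and 2 are allowed, and they start the induction.
\<close>

definition weak_state :: "'a rel \<Rightarrow> 'a set \<Rightarrow> 'a list \<Rightarrow> ('a \<Rightarrow> 'a set) \<Rightarrow> bool" where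
  "weak_state E D ys f \<longleftrightarrow> conn E D \<and> distinct ys \<and> nbh E D \<subseteq> set ys \<and>
     (\<forall>y\<in>set ys. y \<in> f y \<and> conn E (f y) \<and> f y \<inter> D = {}) \<and>
     (\<forall>x\<in>set ys. \<forall>y\<in>set ys. x \<noteq> y \<longrightarrow> f x \<inter> f y = {}) \<and> cyc (touch E f) ys"

text \<open>A weak state may list cycle vertices that are not neighbours of \<open>D\<close>. Such
  surplus entries appear when \<open>D\<close> shrinks or a path is inserted, and
  \<open>weak_state_imp_state\<close> removes them.\<close>

definition state :: "'a rel \<Rightarrow> 'a set \<Rightarrow> 'a list \<Rightarrow> ('a \<Rightarrow> 'a set) \<Rightarrow> bool" where
  "state E D xs f \<longleftrightarrow> weak_state E D xs f \<and> set xs = nbh E D"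

lemma touch_sym: "sym E \<Longrightarrow> touch E f x y \<Longrightarrow> touch E f y x"
  unfolding touch_def by (auto dest: symD)

lemma cyc_rotate1: "cyc P xs \<Longrightarrow> cyc P (rotate1 xs)"
  by (cases xs) (auto simp: cyc_def successively_append_iff successively_Cons)

lemma cyc_rotate: "cyc P xs \<Longrightarrow> cyc P (rotate n xs)"
  by (induction n) (auto simp: cyc_rotate1)

lemma cyc_rev:
  assumes "cyc P xs" "\<And>x y. P x y \<Longrightarrow> P y x"
  shows "cyc P (rev xs)"
proof (cases xs)
  case (Cons x zs)
  have "successively P (x # zs @ [x])" using assms(1) Cons by (simp add: cyc_def)
  then have "successively (\<lambda>x y. P y x) (x # zs @ [x])"
    by (rule successively_mono) (use assms(2) in auto)
  then have "successively P (rev (x # zs @ [x]))" by (subst successively_rev)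
  moreover define w where "w = rev zs @ [x]"
  ultimately have w: "successively P ([x] @ w)" "w \<noteq> []" "last w = x" by simp_all
  then have "successively P w" "P x (hd w)"
    by (simp_all only: successively_append_iff) auto
  then have "successively P (w @ [hd w])"
    using w by (subst successively_append_iff) auto
  then show ?thesis using Cons by (simp add: cyc_def w_def)
qed (simp add: cyc_def)

lemma weak_state_rotate:
  assumes "weak_state E D xs f"
  shows "weak_state E D (rotate n xs) f"
  using assms by (auto simp: weak_state_def cyc_rotate)

lemma state_rotate: "state E D xs f \<Longrightarrow> state E D (rotate n xs) f"
  by (auto simp: state_def weak_state_rotate)

lemma state_rev: "sym E \<Longrightarrow> state E D xs f \<Longrightarrow> state E D (rev xs) f"
  using cyc_rev[of "touch E f" xs, OF _ touch_sym[of E f]]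
  by (simp add: state_def weak_state_def)

lemma rotate_to:
  assumes "y \<in> set ys"
  obtains n zs where "rotate n ys = y # zs"
proof -
  obtain A B where AB: "ys = A @ y # B" using assms by (meson split_list)
  then have "rotate (length A) ys = y # B @ A" by (simp add: rotate_append)
  then show thesis using that by blast
qed

text \<open>This contracts an edge of the cycle minor: the surplus entry \<open>y\<close> is
  absorbed into the branch set of its successor \<open>z\<close>, which thereby inherits the
  adjacency of \<open>y\<close> to its predecessor.\<close>

lemma weak_state_merge:
  assumes "weak_state E D (y # z # zs) f" "y \<notin> nbh E D" "sym E"
  shows "weak_state E D (z # zs) (f(z := f y \<union> f z))"
proof -
  let ?g = "f(z := f y \<union> f z)"
  have mono: "touch E ?g a b" if "touch E f a b" for a b
    using that by (auto simp: touch_def)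
  have dist: "y \<noteq> z" "y \<notin> set zs" "z \<notin> set zs" "distinct zs"
    using assms(1) by (auto simp: weak_state_def)
  have cyc: "touch E f y z" "successively (touch E f) (z # zs)" "touch E f (last (z # zs)) y"
    using assms(1) by (auto simp: weak_state_def cyc_def successively_Cons successively_append_iff)
  have "conn E (f y \<union> f z)"
  proof -
    obtain u v where "u \<in> f y" "v \<in> f z" "(u, v) \<in> E" using cyc(1) dist by (auto simp: touch_def)
    then show ?thesis
      using assms(1) conn_Un_edge[OF assms(3)] by (auto simp: weak_state_def)
  qed
  moreover have "cyc (touch E ?g) (z # zs)"
  proof -
    have 1: "successively (touch E ?g) (z # zs)"
      using cyc(2) mono by (rule successively_mono)
    have "touch E ?g (last (z # zs)) z"
    proof (cases "zs = []")
      case False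
      then have "last zs \<noteq> y" "last zs \<noteq> z" using dist last_in_set by metis+
      then show ?thesis using cyc(3) False by (auto simp: touch_def)
    qed (simp add: touch_def)
    with 1 show ?thesis unfolding cyc_def
      by (subst successively_append_iff) simp
  qed
  ultimately show ?thesis using assms(1,2) dist
    unfolding weak_state_def by (auto 0 3)
qed

lemma weak_state_imp_state:
  assumes "sym E" "weak_state E D ys f"
  shows "\<exists>xs g. state E D xs g"
  using assms(2)
proof (induction "length ys" arbitrary: ys f rule: less_induct)
  case less
  show ?case
  proof (cases "set ys = nbh E D")
  case True
    then have "state E D ys f" using less.prems by (simp add: state_def)
    then show ?thesis by blast
  next
    case False
    then obtain y where y: "y \<in> set ys" "y \<notin> nbh E D" using less.prems by (auto simp: weak_state_def)
    then obtain n zs where rot: "rotate n ys = y # zs" using rotate_to by metis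
    have W: "weak_state E D (y # zs) f" using weak_state_rotate[OF less.prems, of n] rot by simp
    have len: "length ys = Suc (length zs)" using arg_cong[OF rot, of length] by simp
    show ?thesis
    proof (cases zs)
      case Nil
      \<comment> \<open>The only entry \<open>y\<close> is not a neighbour of \<open>D\<close>, so
        \<open>nbh E D\<close> is empty.\<close>
      then have "state E D [] f" using W y by (auto simp: state_def weak_state_def cyc_def)
      then show ?thesis by blast
    next
      case (Cons z zs')
      then have "weak_state E D (z # zs') (f(z := f y \<union> f z))"
        using weak_state_merge[of E D y z zs' f] W y(2) assms(1) by simp
      then show ?thesis using less.hyps[of "z # zs'"] len Cons by simp
    qed
  qed
qed

text \<open>The path fills the step from \<open>last xs\<close> back to \<open>hd xs\<close>, its
  vertices becoming singleton branch sets. The list \<open>xs @ R\<close> is then a weak state for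
  \<open>I\<close>, whose surplus entries can be merged away.\<close>

lemma state_insert_path:
  assumes "sym E" "state E D xs f" "xs \<noteq> []" "gpath E R" "set R \<subseteq> D"
    and "(last xs, hd R) \<in> E" "(last R, hd xs) \<in> E"
    and "conn E I" "I \<subseteq> D" "I \<inter> set R = {}" "nbh E I \<subseteq> set xs \<union> set R"
  shows "\<exists>ys g. state E I ys g"
proof -
  let ?g = "\<lambda>y. if y \<in> set R then {y} else f y"
  have st: "distinct xs" "set xs = nbh E D" "cyc (touch E f) xs"
    "\<And>x. x \<in> set xs \<Longrightarrow> x \<in> f x \<and> conn E (f x) \<and> f x \<inter> D = {}"
    "\<And>x y. x \<in> set xs \<Longrightarrow> y \<in> set xs \<Longrightarrow> x \<noteq> y \<Longrightarrow> f x \<inter> f y = {}"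
    using assms(2) unfolding state_def weak_state_def by blast+
  have disj: "set xs \<inter> set R = {}" using st(2) assms(5) by (auto simp: nbh_def)
  have R: "R \<noteq> []" "distinct R" "successively (\<lambda>x y. (x, y) \<in> E) R"
    using assms(4) by (auto simp: gpath_def)
  have hl: "hd xs \<in> set xs" "last xs \<in> set xs" "hd R \<in> set R" "last R \<in> set R"
    using assms(3) R by auto
  have "successively (touch E f) xs" using st(3) assms(3)
    by (auto simp: cyc_def successively_append_iff)
  then have 1: "successively (touch E ?g) xs"
    by (rule successively_mono) (use disj in \<open>auto simp: touch_def\<close>)
  have 2: "successively (touch E ?g) R"
    using R(3) by (rule successively_mono) (auto simp: touch_def)
  have 3: "touch E ?g (last xs) (hd R)" "touch E ?g (last R) (hd xs)"
    using st(4)[OF hl(1)] st(4)[OF hl(2)] hl disj assms(6,7) by (auto simp: touch_def)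
  have "cyc (touch E ?g) (xs @ R)"
    using 1 2 3 R(1) assms(3) by (auto simp: cyc_def successively_append_iff)
  moreover have "\<forall>y\<in>set (xs @ R). y \<in> ?g y \<and> conn E (?g y) \<and> ?g y \<inter> I = {}"
    using st(4) assms(9,10) by auto
  moreover have "\<forall>x\<in>set (xs @ R). \<forall>y\<in>set (xs @ R). x \<noteq> y \<longrightarrow> ?g x \<inter> ?g y = {}"
  proof (intro ballI impI)
    fix x y assume xy: "x \<in> set (xs @ R)" "y \<in> set (xs @ R)" "x \<noteq> y"
    have "f x \<inter> f y = {}" if "x \<in> set xs" "y \<in> set xs" using st(5) that xy(3) .
    moreover have "f z \<inter> set R = {}" if "z \<in> set xs" for z using st(4)[OF that] assms(5) by blast
    ultimately show "?g x \<inter> ?g y = {}" using xy disj by auto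
  qed
  ultimately have "weak_state E I (xs @ R) ?g"
    using assms(8,11) st(1) R(2) disj unfolding weak_state_def by auto
  then show ?thesis using weak_state_imp_state[OF assms(1)] by blast
qed

text \<open>The vertex \<open>x\<close> is lost as a neighbour, so \<open>v\<close> takes its place
  in the cycle. The branch set of \<open>v\<close> is \<open>f x\<close> enlarged by all of
  \<open>D - I\<close>, which is connected and contains \<open>v\<close>.\<close>

lemma state_replace:
  assumes "sym E" "state E D xs f" "v \<in> D" "is_comp E (D - {v}) I" "x \<in> nbh E D" "x \<notin> nbh E I"
  shows "\<exists>ys g. state E I ys g"
proof -
  have "x \<in> set xs" using assms(2,5) by (auto simp: state_def)
  then obtain n zs where rot: "rotate n xs = x # zs" using rotate_to by metis
  have S: "state E D (x # zs) f" using state_rotate[OF assms(2), of n] rot by simp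
  let ?W = "f x \<union> (D - I)"
  let ?g = "f(v := ?W)"
  have st: "distinct (x # zs)" "set (x # zs) = nbh E D" "cyc (touch E f) (x # zs)"
    "\<And>y. y \<in> set (x # zs) \<Longrightarrow> y \<in> f y \<and> conn E (f y) \<and> f y \<inter> D = {}"
    "\<And>y z. y \<in> set (x # zs) \<Longrightarrow> z \<in> set (x # zs) \<Longrightarrow> y \<noteq> z \<Longrightarrow> f y \<inter> f z = {}"
    using S unfolding state_def weak_state_def by blast+
  have I: "conn E I" "I \<subseteq> D - {v}" using assms(4) by (auto simp: is_comp_def)
  have D: "conn E D" using S by (auto simp: state_def weak_state_def)
  have DI: "conn E (D - I)"
    using conn_Diff_comp[OF assms(1) D conn_singleton _ assms(4)] assms(3) by simp
  obtain d where d: "d \<in> D" "(d, x) \<in> E" using assms(5) by (auto simp: nbh_def)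
  have "x \<notin> D" using assms(5) by (auto simp: nbh_def)
  \<comment> \<open>Otherwise \<open>x\<close> would be a neighbour of \<open>I\<close>. Hence the
    edge between \<open>x\<close> and \<open>d\<close> joins \<open>f x\<close> to
    \<open>D - I\<close>.\<close>
  then have "d \<notin> I" using d assms(6) I by (auto simp: nbh_def)
  have W: "conn E ?W"
    using conn_Un_edge[OF assms(1), of "f x" "D - I" x d] st(4)[of x] DI d \<open>d \<notin> I\<close> symD[OF assms(1)]
    by auto
  have vz: "v \<notin> set (x # zs)" using st(2) assms(3) by (auto simp: nbh_def)
  have "cyc (touch E ?g) (v # zs)"
  proof -
    have succ: "successively (touch E f) ((x # zs) @ [x])" using st(3) by (simp add: cyc_def)
    have 1: "successively (touch E ?g) zs"
    proof (rule successively_mono)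
      show "successively (touch E f) zs" using succ by (auto simp: successively_Cons successively_append_iff)
    qed (use vz in \<open>auto simp: touch_def\<close>)
    show ?thesis
    proof (cases "zs = []")
      case True then show ?thesis by (simp add: cyc_def touch_def)
    next
      case False
      have "touch E f x (hd zs)" "touch E f (last zs) x"
        using succ False by (auto simp: successively_Cons successively_append_iff)
      moreover have "hd zs \<in> set zs" "last zs \<in> set zs" using False by auto
      ultimately have "touch E ?g v (hd zs)" "touch E ?g (last zs) v"
        using vz st(1) by (auto simp: touch_def)
      then show ?thesis using 1 False by (auto simp: cyc_def successively_Cons successively_append_iff)
    qed
  qed
  moreover have "nbh E I \<subseteq> set (v # zs)"
    using comp_nbh_Diff[OF assms(4)] st(2) assms(6) by auto
  moreover have "\<forall>y\<in>set (v # zs). y \<in> ?g y \<and> conn E (?g y) \<and> ?g y \<inter> I = {}"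
    using st(4) W I vz assms(3) by auto
  moreover have "\<forall>y\<in>set (v # zs). \<forall>z\<in>set (v # zs). y \<noteq> z \<longrightarrow> ?g y \<inter> ?g z = {}"
  proof -
    have "?W \<inter> f z = {}" if "z \<in> set zs" for z
      using st(4)[of z] st(5)[of x z] st(1) that by auto
    moreover have "f y \<inter> f z = {}" if "y \<in> set zs" "z \<in> set zs" "y \<noteq> z" for y z
      using st(5)[of y z] that by simp
    ultimately show ?thesis using vz by (simp add: Int_commute)
  qed
  ultimately have "weak_state E I (v # zs) ?g"
    using I(1) st(1) vz unfolding weak_state_def by auto
  then show ?thesis using weak_state_imp_state[OF assms(1)] by blast
qed

section \<open>Decomposing a state\<close>

text \<open>
  A set is good if it has a tree decomposition into bags of at most \<open>M\<close> vertices whose root bag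
  contains the neighbourhood of the set; the root bag is \<open>nbh E D \<union> S\<close>.
\<close>

inductive good :: "'a rel \<Rightarrow> nat \<Rightarrow> 'a set \<Rightarrow> bool" for E :: "'a rel" and M :: nat where
  goodI: "S \<subseteq> D \<Longrightarrow> S \<noteq> {} \<Longrightarrow> card (nbh E D \<union> S) \<le> M \<Longrightarrow>
    (\<And>C. is_comp E (D - S) C \<Longrightarrow> good E M C) \<Longrightarrow> good E M D"

text \<open>The setting of a minimal counterexample \<open>D\<close>. The assumption
  \<open>small\<close> stands for the absence of a \<open>k\<close>-wheel minor, and
  \<open>kM'\<close> says in integers that \<open>M\<close> is at least the integer part of
  \<open>3 * k / 2 - 3\<close>.\<close>

locale bad_state =
  fixes E :: "'a rel" and V :: "'a set" and k M :: nat and D :: "'a set" and xs :: "'a list" and f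
  assumes sym: "sym E" and fin: "finite V" and EV: "E \<subseteq> V \<times> V" and DV: "D \<subseteq> V"
    and kM: "k \<le> M" and kM': "3 * k \<le> 2 * M + 7"
    and st: "state E D xs f" and small: "\<And>I ys g. state E I ys g \<Longrightarrow> I \<subseteq> V \<Longrightarrow> length ys < k"
    and IH: "\<And>I ys g. state E I ys g \<Longrightarrow> I \<subset> D \<Longrightarrow> good E M I"
    and bad: "\<not> good E M D"
begin

section \<open>Consequences of minimality of the counterexample\<close>

lemma finD: "finite D" using DV fin by (rule finite_subset)

lemma symE: "(u, v) \<in> E \<Longrightarrow> (v, u) \<in> E" using sym by (auto dest: symD)

lemma connD: "conn E D" using st by (simp add: state_def weak_state_def)

lemma state_card: "state E I ys g \<Longrightarrow> length ys = card (nbh E I)"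
  by (metis distinct_card state_def weak_state_def)

lemma state_card_less: "state E I ys g \<Longrightarrow> I \<subseteq> V \<Longrightarrow> card (nbh E I) < k"
  using small state_card by metis

lemma finite_nbh: "finite (nbh E I)"
  by (rule finite_subset[OF _ fin]) (use EV in \<open>auto simp: nbh_def\<close>)

text \<open>If \<open>D\<close> had no neighbours, deleting a vertex \<open>v\<close> would leave
  components whose only possible neighbour is \<open>v\<close>. These carry one-vertex cycles, so
  \<open>D\<close> would be good with bag \<open>{v}\<close>.\<close>

lemma xs_nonempty: "xs \<noteq> []"
proof
  assume "xs = []"
  then have N: "nbh E D = {}" using st by (simp add: state_def)
  obtain v where v: "v \<in> D" using conn_nonempty[OF connD] by auto
  have "good E M C" if C: "is_comp E (D - {v}) C" for C
  proof -
    have "nbh E C \<subseteq> {v}" using comp_nbh_Diff[OF C] N by auto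
    moreover have "v \<notin> C" using C by (auto simp: is_comp_def)
    ultimately have "weak_state E C [v] (\<lambda>_. {v})"
      using is_comp_conn[OF C] by (auto simp: weak_state_def cyc_def touch_def)
    then obtain ys g where "state E C ys g" using weak_state_imp_state[OF sym] by blast
    moreover have "C \<subset> D" using C v by (auto simp: is_comp_def)
    ultimately show ?thesis using IH by blast
  qed
  \<comment> \<open>The bag has one vertex; \<open>card (nbh E D) < k\<close> makes
    \<open>k\<close>, and hence \<open>M\<close>, positive.\<close>
  moreover have "card (nbh E D \<union> {v}) \<le> M"
    using N kM state_card_less[OF st DV] by simp
  ultimately show False using bad goodI[of "{v}" D E M] v by blast
qed

text \<open>Otherwise each component of \<open>D - {v}\<close> misses some neighbour of
  \<open>D\<close> and is a state by \<open>state_replace\<close>. Then \<open>nbh E D\<close>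
  together with \<open>v\<close>, at most \<open>k\<close> vertices in all, would be a bag showing
  that \<open>D\<close> is good.\<close>

lemma attached_comp:
  assumes "v \<in> D"
  shows "\<exists>C. is_comp E (D - {v}) C \<and> nbh E D \<subseteq> nbh E C"
proof (rule ccontr)
  assume no: "\<not> ?thesis"
  have "good E M C" if C: "is_comp E (D - {v}) C" for C
  proof -
    obtain x where "x \<in> nbh E D" "x \<notin> nbh E C" using no C by blast
    then obtain ys g where "state E C ys g" using state_replace[OF sym st assms C] by blast
    moreover have "C \<subset> D" using C assms by (auto simp: is_comp_def)
    ultimately show ?thesis using IH by blast
  qed
  moreover have "card (nbh E D \<union> {v}) \<le> M"
    using kM state_card_less[OF st DV] card_Un_le[of "nbh E D" "{v}"] by simp
  ultimately show False using bad goodI[of "{v}" D E M] assms by blast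
qed

text \<open>Two vertices are consecutive in some cyclic order that the fixed branch sets
  \<open>f\<close> admit. Ranging over all such orders makes the relation insensitive to rotation
  and reversal.\<close>

definition nx :: "'a \<Rightarrow> 'a \<Rightarrow> bool" where
  "nx u v \<longleftrightarrow> (\<exists>ys. state E D ys f \<and> ys \<noteq> [] \<and> last ys = u \<and> hd ys = v)"

lemma nx_sym: "nx u v \<Longrightarrow> nx v u"
  unfolding nx_def using state_rev[OF sym] by (metis hd_rev last_rev rev_is_Nil_conv)

text \<open>The path \<open>R\<close> runs through \<open>D\<close> parallel to the step from
  \<open>last ys\<close> back to \<open>hd ys\<close>; rotating the list moves any step of the cycle
  there.\<close>

definition link :: "'a list \<Rightarrow> 'a list \<Rightarrow> 'a set \<Rightarrow> bool" where
  "link ys R H \<longleftrightarrow> state E D ys f \<and> ys \<noteq> [] \<and> gpath E R \<and> set R \<subseteq> D \<and>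
     (last ys, hd R) \<in> E \<and> (last R, hd ys) \<in> E \<and> is_comp E (D - set R) H"

text \<open>After deleting some \<open>v\<close>, a component attached to all of
  \<open>nbh E D\<close> remains, and \<open>R\<close> is chosen inside it.\<close>

lemma link_exists: "\<exists>ys R H. link ys R H"
proof -
  have X: "set xs = nbh E D" using st by (simp add: state_def)
  have "last xs \<in> nbh E D" "hd xs \<in> nbh E D"
    using last_in_set[OF xs_nonempty] hd_in_set[OF xs_nonempty] unfolding X .
  then obtain v where v: "v \<in> D" "(v, last xs) \<in> E" by (auto simp: nbh_def)
  obtain C where C: "is_comp E (D - {v}) C" "nbh E D \<subseteq> nbh E C" using attached_comp v by blast
  have "last xs \<in> nbh E C" "hd xs \<in> nbh E C"
    using C(2) \<open>last xs \<in> nbh E D\<close> \<open>hd xs \<in> nbh E D\<close> by auto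
  then obtain w w' where w: "w \<in> C" "(w, last xs) \<in> E" "w' \<in> C" "(w', hd xs) \<in> E"
    by (auto simp: nbh_def)
  obtain R where R: "gpath E R" "set R \<subseteq> C" "hd R = w" "last R = w'"
    using conn_gpath[OF is_comp_conn[OF C(1)] w(1,3)] .
  \<comment> \<open>The deleted vertex ensures that \<open>D - set R\<close> is nonempty and so has
    a component.\<close>
  have "v \<in> D - set R" using v R C by (auto simp: is_comp_def)
  then obtain H where "is_comp E (D - set R) H" using comp_exists[OF sym] by metis
  then have "link xs R H"
    using st xs_nonempty R w C(1) symE unfolding link_def by (auto simp: is_comp_def)
  then show ?thesis by blast
qed

lemma link_max: "\<exists>ys R H. link ys R H \<and> (\<forall>ys' R' H'. link ys' R' H' \<longrightarrow> card H' \<le> card H)"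
proof -
  let ?P = "\<lambda>H. \<exists>ys R. link ys R H"
  have "\<exists>H. ?P H" using link_exists by blast
  moreover have "\<forall>H. ?P H \<longrightarrow> card H < Suc (card D)"
  proof (intro allI impI)
    fix H assume "?P H"
    then have "H \<subseteq> D" by (auto simp: link_def is_comp_def)
    then show "card H < Suc (card D)" using card_mono[OF finD] by (simp add: le_imp_less_Suc)
  qed
  ultimately obtain H where "?P H" "\<forall>H'. ?P H' \<longrightarrow> card H' \<le> card H"
    using ex_has_greatest_nat[of ?P _ card "Suc (card D)"] by blast
  then show ?thesis by blast
qed

end

section \<open>Structure around a largest component left by a linking path\<close>

locale max_link = bad_state +
  fixes ys :: "'a list" and R :: "'a list" and H :: "'a set"
  assumes lnk: "link ys R H"
    and mx: "\<And>ys' R' H'. link ys' R' H' \<Longrightarrow> card H' \<le> card H"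
begin

text \<open>The set \<open>S\<close> turns out to lie on \<open>R\<close>. The root bag for
  \<open>D\<close> will be \<open>nbh E D \<union> S\<close>, which is also
  \<open>nbh E H \<union> Z\<close>, so its size is controlled by bounding \<open>Z\<close>.\<close>

definition "S = nbh E H \<inter> D"
definition "A = D - H"
definition "Z = nbh E D - nbh E H"

lemma R: "gpath E R" "set R \<subseteq> D" "(last ys, hd R) \<in> E" "(last R, hd ys) \<in> E" "R \<noteq> []"
  and H: "is_comp E (D - set R) H" "conn E H" "H \<subseteq> D" "H \<inter> set R = {}"
  and ys: "state E D ys f" "ys \<noteq> []" "set ys = nbh E D" "distinct ys"
  using lnk by (auto simp: link_def is_comp_def gpath_def state_def weak_state_def)

lemma RA: "set R \<subseteq> A" using R H by (auto simp: A_def)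

lemma connA: "conn E A"
  unfolding A_def using conn_Diff_comp[OF sym connD gpath_conn[OF sym R(1)] R(2) H(1)] .

lemma S_R: "S \<subseteq> set R"
  using is_comp_nbh[OF H(1)] by (auto simp: S_def)

lemma S_A: "S \<subseteq> A" using S_R RA by auto

lemma S_nonempty: "S \<noteq> {}"
proof -
  have "\<not> D \<subseteq> H" using R(2,5) H(4) by (metis inf.absorb_iff2 set_empty subset_trans)
  moreover have "D \<inter> H \<noteq> {}" using H(3) conn_nonempty[OF H(2)] by auto
  ultimately obtain u v where "u \<in> H" "v \<in> D" "v \<notin> H" "(u, v) \<in> E"
    using conn_exit[OF connD, of H] by metis
  then show ?thesis by (auto simp: S_def nbh_def)
qed

lemma nbh_H: "nbh E H = (nbh E D - Z) \<union> S"
  using H(3) by (auto simp: nbh_def S_def Z_def)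

lemma stateH: "\<exists>zs g. state E H zs g"
proof (rule state_insert_path[OF sym ys(1,2) R(1-4) H(2-4)])
  show "nbh E H \<subseteq> set ys \<union> set R" using nbh_H S_R ys(3) by auto
qed

lemma card_nbh_H: "card (nbh E H) < k"
  using stateH state_card_less H(3) DV by blast

lemma edge_H_A: "h \<in> H \<Longrightarrow> (h, a) \<in> E \<Longrightarrow> a \<in> A \<Longrightarrow> a \<in> S"
  by (auto simp: S_def A_def nbh_def)

text \<open>Otherwise a path inside \<open>W\<close> would leave a component larger than \<open>H\<close>.\<close>

lemma S_subset:
  assumes "nx u v" "conn E W" "W \<subseteq> A" "w \<in> W" "(w, u) \<in> E" "w' \<in> W" "(w', v) \<in> E"
  shows "S \<subseteq> W"
proof
  fix s assume s: "s \<in> S"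
  obtain P where P: "gpath E P" "set P \<subseteq> W" "hd P = w" "last P = w'"
    using conn_gpath[OF assms(2,4,6)] .
  have "H \<subseteq> D - set P" using P(2) assms(3) H(3) by (auto simp: A_def)
  then obtain H' where H': "is_comp E (D - set P) H'" "H \<subseteq> H'"
    using comp_exists_conn[OF sym H(2)] by metis
  obtain zs where "state E D zs f" "zs \<noteq> []" "last zs = u" "hd zs = v"
    using assms(1) by (auto simp: nx_def)
  then have "link zs P H'"
    using P H'(1) assms(3,5,7) symE by (auto simp: link_def A_def)
  then have "card H' \<le> card H" by (rule mx)
  moreover have "finite H'" using H'(1) finD by (auto simp: is_comp_def intro: finite_subset)
  \<comment> \<open>Maximality now makes \<open>H\<close> itself a component of
    \<open>D - set P\<close>, so none of its neighbours in \<open>D\<close> can lie off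
    \<open>P\<close>.\<close>
  ultimately have "H' = H" using H'(2) card_seteq by blast
  show "s \<in> W"
  proof (rule ccontr)
    assume "s \<notin> W"
    then have "s \<in> nbh E H \<inter> (D - set P)" using s P(2) by (auto simp: S_def)
    then show False using is_comp_nbh[OF H'(1)] \<open>H' = H\<close> by blast
  qed
qed

lemma Z_nbh: "z \<in> Z \<Longrightarrow> d \<in> D \<Longrightarrow> (d, z) \<in> E \<Longrightarrow> d \<in> A"
  using H(3) by (auto simp: Z_def A_def nbh_def)

text \<open>
  Take a path in \<open>A\<close> between neighbours of \<open>z\<close> and \<open>y\<close>, and its first vertex \<open>s\<close> in \<open>S\<close>.  As \<open>D - {s}\<close> has
  a component attached to both \<open>z\<close> and \<open>y\<close>, one can get around \<open>s\<close> within \<open>A\<close>, against \<open>S_subset\<close>.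
\<close>

lemma Z_isolated:
  assumes nx: "nx z y" and z: "z \<in> Z" and w': "w' \<in> A" "(w', y) \<in> E" and y: "y \<in> nbh E D"
  shows False
proof -
  obtain d where d: "d \<in> D" "(d, z) \<in> E" using z by (auto simp: Z_def nbh_def)
  then have "d \<in> A" using Z_nbh z by blast
  obtain P where P: "gpath E P" "set P \<subseteq> A" "hd P = d" "last P = w'"
    using conn_gpath[OF connA \<open>d \<in> A\<close> w'(1)] .
  have Pne: "P \<noteq> []" using P(1) by (simp add: gpath_def)
  have "S \<subseteq> set P"
    by (rule S_subset[OF nx gpath_conn[OF sym P(1)] P(2), of d w']) (use P d w' Pne in auto)
  then have "\<exists>x\<in>set P. x \<in> S" using S_nonempty by blast
  then obtain P1 s P2 where PS: "P = P1 @ s # P2" "s \<in> S" "\<forall>x\<in>set P1. x \<notin> S"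
    using split_list_first_prop[of P "\<lambda>x. x \<in> S"] by blast
  \<comment> \<open>All of \<open>S\<close> lies on \<open>P\<close> and \<open>s\<close> comes
    first, so the other vertices of \<open>S\<close> lie beyond \<open>s\<close>.\<close>
  have SP2: "S \<subseteq> insert s (set P2)" using PS \<open>S \<subseteq> set P\<close> by auto
  have sP2: "s \<notin> set P2" using PS P(1) by (auto simp: gpath_def)
  have "s \<in> D" using PS(2) by (auto simp: S_def)
  then obtain C where C: "is_comp E (D - {s}) C" "nbh E D \<subseteq> nbh E C" using attached_comp by blast
  have "z \<in> nbh E C" "y \<in> nbh E C" using C(2) z y by (auto simp: Z_def)
  then obtain w v where w: "w \<in> C" "(w, z) \<in> E" and v: "v \<in> C" "(v, y) \<in> E"
    by (auto simp: nbh_def)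
  have CD: "C \<subseteq> D - {s}" "conn E C" using C by (auto simp: is_comp_def)
  have wA: "w \<in> A - {s}" using Z_nbh[OF z] w CD by auto
  show False
  proof (cases "C \<inter> H = {}")
    case True
    then have "C \<subseteq> A" using CD by (auto simp: A_def)
    then have "S \<subseteq> C" using S_subset[OF nx CD(2) _ w v] by blast
    then show False using PS(2) CD by auto
  next
    case False
    \<comment> \<open>\<open>W\<close> collects what \<open>w\<close> reaches in \<open>A\<close>
      without \<open>s\<close>. The set \<open>C\<close> leaves \<open>W\<close> only into
      \<open>H\<close>, and the vertex \<open>t\<close> of exit lies in \<open>S\<close> and thus on
      \<open>P2\<close>. So \<open>W\<close> and \<open>P2\<close> together join \<open>z\<close> to
      \<open>y\<close> within \<open>A\<close>, avoiding \<open>s\<close>.\<close>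
    obtain W where W: "is_comp E (A - {s}) W" "w \<in> W" using comp_exists[OF sym wA] .
    have "\<not> C \<subseteq> W" using False W(1) by (auto simp: is_comp_def A_def)
    moreover have "C \<inter> W \<noteq> {}" using w W by auto
    ultimately obtain t q where t: "t \<in> W" "q \<in> C" "q \<notin> W" "(t, q) \<in> E"
      using conn_exit[OF CD(2)] by metis
    have "q \<notin> A - {s}" using W(1) t by (auto simp: is_comp_def nbh_def)
    then have "q \<in> H" using t(2) CD by (auto simp: A_def)
    have "t \<in> A - {s}" using t(1) W(1) by (auto simp: is_comp_def)
    then have "t \<in> S" using edge_H_A[OF \<open>q \<in> H\<close> symE[OF t(4)]] by auto
    then have tP2: "t \<in> set P2" using SP2 \<open>t \<in> A - {s}\<close> by auto
    then have P2: "P2 \<noteq> []" by auto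
    have "gpath E P2" using P(1) PS(1) P2
      by (auto simp: gpath_def successively_append_iff successively_Cons)
    then have "conn E (W \<union> set P2)"
      using conn_Un[OF sym is_comp_conn[OF W(1)] gpath_conn[OF sym]] t(1) tP2 by blast
    moreover have "W \<union> set P2 \<subseteq> A" using W(1) P(2) PS(1) by (auto simp: is_comp_def)
    moreover have "w' \<in> set P2" using P(4) PS(1) P2 by auto
    ultimately have "S \<subseteq> W \<union> set P2" using S_subset[OF nx _ _ _ w(2) _ w'(2)] W(2) by blast
    then show False using PS(2) sP2 W(1) by (auto simp: is_comp_def)
  qed
qed

text \<open>The ends of \<open>R\<close> lie in \<open>A\<close> and are adjacent to the two cycle
  vertices that \<open>R\<close> joins. Applying \<open>Z_isolated\<close> in both directions keeps
  these two vertices out of \<open>Z\<close>.\<close>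

lemma ends:
  shows "hd ys \<in> nbh E H" "last ys \<in> nbh E H"
    and "hd ys \<in> nbh E D" "last ys \<in> nbh E D"
    and "hd R \<in> A" "last R \<in> A" and "nx (last ys) (hd ys)"
proof -
  show e: "hd ys \<in> nbh E D" "last ys \<in> nbh E D"
    using last_in_set[OF ys(2)] hd_in_set[OF ys(2)] unfolding ys(3) by simp_all
  show hdA: "hd R \<in> A" "last R \<in> A" using RA R(5) by auto
  show nxb: "nx (last ys) (hd ys)" using ys by (auto simp: nx_def)
  have "last ys \<notin> Z" using Z_isolated[OF nxb _ hdA(2) R(4) e(1)] by blast
  moreover have "hd ys \<notin> Z"
    using Z_isolated[OF nx_sym[OF nxb] _ hdA(1) symE[OF R(3)] e(2)] by blast
  ultimately show "hd ys \<in> nbh E H" "last ys \<in> nbh E H" using e by (auto simp: Z_def)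
qed

text \<open>A rotation moves the seam of the list between positions \<open>j\<close> and
  \<open>Suc j\<close>.\<close>

lemma nx_nth:
  assumes "Suc j < length ys"
  shows "nx (ys ! j) (ys ! Suc j)"
proof -
  let ?zs = "rotate (Suc j) ys"
  have "state E D ?zs f" using state_rotate ys(1) by blast
  moreover have "?zs = drop (Suc j) ys @ take (Suc j) ys"
    using assms by (simp add: rotate_drop_take)
  then have "last ?zs = ys ! j" "hd ?zs = ys ! Suc j" "?zs \<noteq> []"
    using assms by (auto simp: hd_drop_conv_nth take_Suc_conv_app_nth hd_append)
  ultimately show ?thesis by (auto simp: nx_def)
qed

text \<open>By \<open>Z_isolated\<close>, a cyclic neighbour of a vertex of \<open>Z\<close> has no
  neighbour in \<open>A\<close>, whereas vertices of \<open>Z\<close> and both ends of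
  \<open>ys\<close> do have one. So positions of \<open>Z\<close> are never consecutive, and they
  avoid the first two and the last two places.\<close>

lemma card_Z: "Z = {} \<or> 2 * card Z + 3 \<le> card (nbh E D)"
proof (cases "Z = {}")
  case False
  let ?n = "length ys"
  define J where "J = {j. j < ?n \<and> ys ! j \<in> Z}"
  have n: "?n = card (nbh E D)" using ys by (metis distinct_card)
  have nbd: "ys ! j \<in> nbh E D" if "j < ?n" for j using that ys(3) nth_mem by blast
  note hdA = ends(5,6)
  have lastZ: "last ys \<notin> Z" and hdZ: "hd ys \<notin> Z" using ends(1,2) by (auto simp: Z_def)
  have zn: "\<exists>w\<in>A. (w, x) \<in> E" if "x \<in> Z" for x
    using that Z_nbh[OF that] by (auto simp: Z_def nbh_def)
  have J1: "Suc j < ?n" "0 < j" if "j \<in> J" for j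
  proof -
    have "ys ! j \<noteq> last ys" "ys ! j \<noteq> hd ys" using that lastZ hdZ by (auto simp: J_def)
    then have "j \<noteq> ?n - 1" "j \<noteq> 0" using last_conv_nth[OF ys(2)] hd_conv_nth[OF ys(2)] by metis+
    then show "Suc j < ?n" "0 < j" using that by (auto simp: J_def)
  qed
  have succ: "\<not> (\<exists>w\<in>A. (w, ys ! Suc j) \<in> E)" if "j \<in> J" for j
    using Z_isolated[OF nx_nth[OF J1(1)[OF that]]] that nbd[OF J1(1)[OF that]] by (auto simp: J_def)
  have pred: "\<not> (\<exists>w\<in>A. (w, ys ! (j - 1)) \<in> E)" if "j \<in> J" for j
  proof -
    have j: "Suc (j - 1) = j" using J1[OF that] by simp
    have "nx (ys ! j) (ys ! (j - 1))"
      using nx_sym[OF nx_nth[of "j - 1"]] J1[OF that] j by simp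
    then show ?thesis
      using Z_isolated[of "ys ! j" "ys ! (j - 1)"] that nbd[of "j - 1"] J1[OF that] by (auto simp: J_def)
  qed
  \<comment> \<open>Position 1 is excluded because its predecessor \<open>hd ys\<close> is adjacent
    to \<open>last R\<close> in \<open>A\<close>; symmetrically, the last position but one precedes
    \<open>last ys\<close>, which is adjacent to \<open>hd R\<close>.\<close>
  have J2: "2 \<le> j" "Suc j < ?n - 1" if "j \<in> J" for j
  proof -
    have "j - 1 \<noteq> 0"
      using pred[OF that] hdA(2) R(4) ys(2) by (auto simp: hd_conv_nth)
    then show "2 \<le> j" by simp
    have "Suc j \<noteq> ?n - 1"
      using succ[OF that] hdA(1) symE[OF R(3)] ys(2) by (auto simp: last_conv_nth)
    then show "Suc j < ?n - 1" using J1[OF that] by simp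
  qed
  have "Suc j \<notin> J" if "j \<in> J" for j
    using succ[OF that] zn[of "ys ! Suc j"] by (auto simp: J_def)
  then have disj: "J \<inter> Suc ` J = {}" by blast
  have finJ: "finite J" by (simp add: J_def)
  have "card (J \<union> Suc ` J) = 2 * card J"
    using disj finJ by (simp add: card_Un_disjoint card_image)
  \<comment> \<open>The interval has \<open>?n - 3\<close> elements, and each position in
    \<open>J\<close> uses up two of them.\<close>
  moreover have "J \<union> Suc ` J \<subseteq> {2..<?n - 1}" using J2 by fastforce
  then have "card (J \<union> Suc ` J) \<le> ?n - 1 - 2" using card_mono[of "{2..<?n - 1}"] by fastforce
  moreover have "card Z = card J"
  proof -
    have "Z = (\<lambda>j. ys ! j) ` J"
    proof
      show "Z \<subseteq> (\<lambda>j. ys ! j) ` J"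
      proof
        fix x assume x: "x \<in> Z"
        then have "x \<in> set ys" using ys(3) by (auto simp: Z_def)
        then obtain j where "j < ?n" "ys ! j = x" by (auto simp: in_set_conv_nth)
        then show "x \<in> (\<lambda>j. ys ! j) ` J" using x by (auto simp: J_def)
      qed
    qed (auto simp: J_def)
    moreover have "inj_on (\<lambda>j. ys ! j) J"
      using ys(4) by (auto simp: J_def inj_on_def nth_eq_iff_index_eq)
    ultimately show ?thesis by (simp add: card_image)
  qed
  moreover have "J \<noteq> {}"
  proof -
    have "card Z \<noteq> 0" using False finite_nbh by (auto simp: Z_def)
    then show ?thesis using \<open>card Z = card J\<close> by auto
  qed
  \<comment> \<open>This keeps the natural-number subtraction \<open>?n - 1 - 2\<close> from being
    truncated.\<close>
  then have "4 \<le> ?n" using J2 by fastforce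
  ultimately show ?thesis using n by auto
qed auto

text \<open>The bag is \<open>nbh E H \<union> Z\<close>. If \<open>Z\<close> is empty, it has fewer
  than \<open>k\<close> vertices; otherwise it has at most
  \<open>(k - 1) + (k - 4) / 2 = (3 * k - 6) / 2\<close>.\<close>

lemma card_bag: "card (nbh E D \<union> S) \<le> M"
proof -
  have "nbh E D \<union> S = nbh E H \<union> Z" using nbh_H by (auto simp: Z_def)
  then have "card (nbh E D \<union> S) \<le> card (nbh E H) + card Z" by (simp add: card_Un_le)
  moreover have "card (nbh E D) < k" using state_card_less st DV by blast
  ultimately show ?thesis using card_nbh_H card_Z kM kM' by auto
qed

text \<open>Removing \<open>S\<close> instead of all of \<open>R\<close> still isolates
  \<open>H\<close>, since \<open>S\<close> contains all its neighbours in \<open>D\<close>.\<close>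

lemma comp_H: "is_comp E (D - S) H"
  using H(2,3) by (auto simp: is_comp_def S_def nbh_def)

lemma path_set_S:
  assumes "conn E W" "W \<subseteq> A" "hd R \<in> W" "last R \<in> W"
  shows "S \<subseteq> W"
  by (rule S_subset[OF ends(7) assms(1-3) _ assms(4) R(4)]) (rule symE[OF R(3)])

text \<open>
  By \<open>path_set_S\<close>, the component \<open>I\<close> is attached to at most two vertices of \<open>S\<close>, consecutive among
  those on \<open>R\<close>.  The part of \<open>R\<close> that meets \<open>I\<close> is replaced by a path through \<open>H\<close>.
\<close>

lemma state_other_comp:
  assumes I: "is_comp E (D - S) I" "I \<noteq> H"
  shows "\<exists>zs g. state E I zs g"
proof -
  have IH: "I \<inter> H = {}" using comp_disjoint[OF I(1) comp_H I(2)] .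
  have cI: "conn E I" and ID: "I \<subseteq> D - S" using I(1) by (auto simp: is_comp_def)
  have IA: "I \<subseteq> A" using ID IH by (auto simp: A_def)
  define N where "N = nbh E I \<inter> D"
  have NS: "N \<subseteq> S" using is_comp_nbh[OF I(1)] by (auto simp: N_def)
  have nbhI: "nbh E I \<subseteq> nbh E D \<union> N" using ID by (auto simp: nbh_def N_def)
  have "N \<noteq> {}"
  proof -
    have "\<not> D \<subseteq> I" using S_nonempty ID S_A by (auto simp: A_def)
    moreover have "D \<inter> I \<noteq> {}" using ID conn_nonempty[OF cI] by auto
    ultimately obtain u v where "u \<in> I" "v \<in> D" "v \<notin> I" "(u, v) \<in> E"
      using conn_exit[OF connD, of I] by metis
    then show ?thesis by (auto simp: N_def nbh_def)
  qed
  \<comment> \<open>The vertices \<open>a\<close> and \<open>b\<close> are the first and the last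
    vertex of \<open>N\<close> along \<open>R\<close>; they may coincide.\<close>
  then have "\<exists>x\<in>set R. x \<in> N" using NS S_R by blast
  then obtain P a T' where PaT: "R = P @ a # T'" "a \<in> N" "\<forall>x\<in>set P. x \<notin> N"
    using split_list_first_prop[of R "\<lambda>x. x \<in> N"] by blast
  have "\<exists>x\<in>set (a # T'). x \<in> N" using PaT(2) by auto
  then obtain Q' b T where QbT: "a # T' = Q' @ b # T" "b \<in> N" "\<forall>x\<in>set T. x \<notin> N"
    using split_list_last_prop[of "a # T'" "\<lambda>x. x \<in> N"] by blast
  have nb: "\<exists>i\<in>I. (i, c) \<in> E" "\<exists>h\<in>H. (h, c) \<in> E" "c \<in> S" "c \<in> A" "c \<notin> I" "c \<in> D" "c \<notin> H"
    if "c \<in> N" for c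
    using that NS S_A by (auto simp: N_def S_def nbh_def A_def)
  have seg: "conn E (set Y)" if "R = X @ Y @ X'" "Y \<noteq> []" for X Y X'
    using R(1) that by (intro gpath_conn[OF sym]) (auto simp: gpath_def successively_append_iff)
  have RI: "set R \<subseteq> A" using RA .
  have touchN: "conn E (I \<union> W)" if "conn E W" "c \<in> N" "c \<in> W" for W c
    using nb(1)[OF that(2)] conn_Un_edge[OF sym cI that(1) _ that(3)] by blast
  have meetN: "conn E (I \<union> W)" if "conn E W" "W \<inter> I \<noteq> {}" for W
    using conn_Un[OF sym cI that(1)] that(2) by blast
  have RH: "set R \<inter> H = {}" using H(4) by auto
  obtain h0 where h0: "h0 \<in> H" "(h0, last ys) \<in> E" using ends(2) by (auto simp: nbh_def)
  obtain h1 where h1: "h1 \<in> H" "(h1, hd ys) \<in> E" using ends(1) by (auto simp: nbh_def)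
  obtain ha where ha: "ha \<in> H" "(ha, a) \<in> E" using nb(2)[OF PaT(2)] by blast
  obtain hb where hb: "hb \<in> H" "(hb, b) \<in> E" using nb(2)[OF QbT(2)] by blast
  have dR: "distinct R" "successively (\<lambda>x y. (x, y) \<in> E) R" using R(1) by (auto simp: gpath_def)
  \<comment> \<open>It suffices to find a path \<open>R'\<close> through \<open>D\<close> for the
    same step of the cycle that avoids \<open>I\<close> and contains \<open>N\<close>.\<close>
  have fin: ?thesis
    if "gpath E R'" "set R' \<subseteq> D" "(last ys, hd R') \<in> E" "(last R', hd ys) \<in> E" "I \<inter> set R' = {}"
      "N \<subseteq> set R'" for R'
    by (rule state_insert_path[OF sym ys(1,2) that(1-4) cI _ that(5)])
      (use ID nbhI that(6) ys(3) in auto)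
  show ?thesis
  proof (cases Q')
    case Nil
    then have ab: "a = b" and RT: "R = P @ a # T" using QbT(1) PaT(1) by auto
    have Na: "N \<subseteq> {a}" using NS S_R RT PaT(3) QbT(3) by auto
    \<comment> \<open>If \<open>I\<close> met both sides of \<open>a\<close>, then \<open>I\<close>,
      \<open>P\<close> and \<open>T\<close> would form a connected set in \<open>A\<close>
      containing both ends of \<open>R\<close> but not \<open>a\<close>, against
      \<open>path_set_S\<close>.\<close>
    have notboth: "set P \<inter> I = {} \<or> set T \<inter> I = {}"
    proof (rule ccontr)
      assume "\<not> ?thesis"
      then have PI: "set P \<inter> I \<noteq> {}" and TI: "set T \<inter> I \<noteq> {}" by auto
      then have ne: "P \<noteq> []" "T \<noteq> []" by auto
      have "conn E (I \<union> set P)" using meetN[OF seg[of "[]" P "a # T"] PI] RT ne by simp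
      moreover have "conn E (I \<union> set T)" using meetN[OF seg[of "P @ [a]" T "[]"] TI] RT ne by simp
      ultimately have "conn E ((I \<union> set P) \<union> (I \<union> set T))"
        using conn_Un[OF sym] conn_nonempty[OF cI] by blast
      then have "S \<subseteq> (I \<union> set P) \<union> (I \<union> set T)"
        by (rule path_set_S) (use IA RI RT ne in auto)
      then show False using nb(3,5)[OF PaT(2)] dR(1) RT by auto
    qed
    show ?thesis
    proof (cases "set P \<inter> I = {}")
      case False
      \<comment> \<open>The initial part \<open>P\<close> meets \<open>I\<close>, so it is replaced
        by a path in \<open>H\<close> from a neighbour of \<open>last ys\<close> to a neighbour of
        \<open>a\<close>.\<close>
      obtain P1 where P1: "gpath E P1" "set P1 \<subseteq> H" "hd P1 = h0" "last P1 = ha"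
        using conn_gpath[OF H(2) h0(1) ha(1)] .
      show ?thesis
      proof (rule fin[of "P1 @ a # T"])
        show "gpath E (P1 @ a # T)"
          using P1 dR RT RH ha(2)
          by (auto simp: gpath_def successively_append_iff successively_Cons)
        show "set (P1 @ a # T) \<subseteq> D" using P1 R(2) RT H(3) by auto
        show "(last ys, hd (P1 @ a # T)) \<in> E" using P1 h0 symE by (auto simp: gpath_def)
        show "(last (P1 @ a # T), hd ys) \<in> E" using R(4) RT by auto
        show "I \<inter> set (P1 @ a # T) = {}" using P1 IH notboth False nb(5)[OF PaT(2)] by auto
        show "N \<subseteq> set (P1 @ a # T)" using Na by auto
      qed
    next
      case PI: True
      show ?thesis
      proof (cases "set T \<inter> I = {}")
        case True
        show ?thesis
          by (rule fin[OF R(1-4)]) (use True PI nb(5)[OF PaT(2)] NS S_R RT in auto)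
      next
        case False
        \<comment> \<open>Here the final part \<open>T\<close> meets \<open>I\<close>, and
          \<open>H\<close> provides a detour from \<open>a\<close> to \<open>hd ys\<close>.\<close>
        obtain P1 where P1: "gpath E P1" "set P1 \<subseteq> H" "hd P1 = ha" "last P1 = h1"
          using conn_gpath[OF H(2) ha(1) h1(1)] .
        show ?thesis
        proof (rule fin[of "P @ a # P1"])
          show "gpath E (P @ a # P1)"
            using P1 dR RT RH symE[OF ha(2)]
            by (auto simp: gpath_def successively_append_iff successively_Cons)
          show "set (P @ a # P1) \<subseteq> D" using P1 R(2) RT H(3) by auto
          show "(last ys, hd (P @ a # P1)) \<in> E" using R(3) RT by (cases P) auto
          show "(last (P @ a # P1), hd ys) \<in> E" using P1 h1 by (auto simp: gpath_def)
          show "I \<inter> set (P @ a # P1) = {}" using P1 IH PI nb(5)[OF PaT(2)] by auto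
          show "N \<subseteq> set (P @ a # P1)" using Na by auto
        qed
      qed
    qed
  next
    case (Cons a' Q)
    then have RT: "R = P @ a # Q @ b # T" using QbT(1) PaT(1) by auto
    have c1: "conn E (set (P @ [a]))" "conn E (set (b # T))"
      using seg[of "[]" "P @ [a]" "Q @ b # T"] seg[of "P @ a # Q" "b # T" "[]"] RT by auto
    have "last R = last (b # T)" using RT by simp
    then have hl: "hd R \<in> set (P @ [a])" "last R \<in> set (b # T)"
      using RT last_in_set[of "b # T"] by (auto simp: hd_append)
    have abs: "a \<noteq> b" "a \<notin> set P" "b \<notin> set P" "a \<notin> set T" "b \<notin> set T" using dR(1) RT by auto
    have join: "conn E ((I \<union> W) \<union> (I \<union> W'))" if "conn E (I \<union> W)" "conn E (I \<union> W')" for W W'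
      using conn_Un[OF sym that] conn_nonempty[OF cI] by blast
    \<comment> \<open>Being attached to both \<open>a\<close> and \<open>b\<close>, \<open>I\<close>
      bridges \<open>Q\<close>; hence no vertex of \<open>S\<close> on \<open>Q\<close> lies outside
      this set.\<close>
    have "S \<subseteq> (I \<union> set (P @ [a])) \<union> (I \<union> set (b # T))"
      by (rule path_set_S[OF join])
        (use touchN[OF c1(1) PaT(2)] touchN[OF c1(2) QbT(2)] IA RI RT hl in auto)
    then have Nab: "N \<subseteq> {a, b}" using NS nb(5) PaT(3) QbT(3) by auto
    \<comment> \<open>If \<open>I\<close> met \<open>P\<close>, one could pass from \<open>P\<close>
      through \<open>I\<close> to \<open>b\<close> and bypass \<open>a\<close>, although
      \<open>a\<close> is in \<open>S\<close>. The argument for \<open>T\<close> and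
      \<open>b\<close> is symmetric.\<close>
    have PI: "set P \<inter> I = {}"
    proof (rule ccontr)
      assume PI: "set P \<inter> I \<noteq> {}"
      then have ne: "P \<noteq> []" by auto
      have "conn E (I \<union> set P)" using meetN[OF seg[of "[]" P "a # Q @ b # T"] PI] RT ne by simp
      then have "S \<subseteq> (I \<union> set P) \<union> (I \<union> set (b # T))"
        by (intro path_set_S[OF join])
          (use touchN[OF c1(2) QbT(2)] IA RI RT hl ne in auto)
      then show False using nb(3,5)[OF PaT(2)] abs by auto
    qed
    have TI: "set T \<inter> I = {}"
    proof (rule ccontr)
      assume TI: "set T \<inter> I \<noteq> {}"
      then have ne: "T \<noteq> []" by auto
      have "conn E (I \<union> set T)" using meetN[OF seg[of "P @ a # Q @ [b]" T "[]"] TI] RT ne by simp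
      then have "S \<subseteq> (I \<union> set (P @ [a])) \<union> (I \<union> set T)"
        by (intro path_set_S[OF join])
          (use touchN[OF c1(1) PaT(2)] IA RI RT hl ne in auto)
      then show False using nb(3,5)[OF QbT(2)] abs by auto
    qed
    \<comment> \<open>Only the middle segment \<open>Q\<close> can meet \<open>I\<close>; the path
      \<open>P1\<close> through \<open>H\<close> replaces it.\<close>
    obtain P1 where P1: "gpath E P1" "set P1 \<subseteq> H" "hd P1 = ha" "last P1 = hb"
      using conn_gpath[OF H(2) ha(1) hb(1)] .
    show ?thesis
    proof (rule fin[of "P @ a # P1 @ b # T"])
      show "gpath E (P @ a # P1 @ b # T)"
        using P1 dR RT RH symE[OF ha(2)] hb(2)
        by (auto simp: gpath_def successively_append_iff successively_Cons)
      show "set (P @ a # P1 @ b # T) \<subseteq> D" using P1 R(2) RT H(3) by auto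
      show "(last ys, hd (P @ a # P1 @ b # T)) \<in> E" using R(3) RT by (cases P) auto
      show "(last (P @ a # P1 @ b # T), hd ys) \<in> E" using R(4) RT by auto
      show "I \<inter> set (P @ a # P1 @ b # T) = {}"
        using P1 IH PI TI nb(5)[OF PaT(2)] nb(5)[OF QbT(2)] by auto
      show "N \<subseteq> set (P @ a # P1 @ b # T)" using Nab by auto
    qed
  qed
qed

lemma contradiction: False
proof -
  have "good E M C" if C: "is_comp E (D - S) C" for C
  proof -
    have "\<exists>zs g. state E C zs g" using stateH state_other_comp[OF C] by blast
    moreover have "C \<subset> D" using C S_nonempty S_A by (auto simp: is_comp_def A_def)
    ultimately show ?thesis using IH by blast
  qed
  moreover have "S \<subseteq> D" by (simp add: S_def)
  ultimately show False using bad goodI[OF _ S_nonempty card_bag] by blast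
qed

end

lemma state_good:
  assumes "sym E" "finite V" "E \<subseteq> V \<times> V" "k \<le> M" "3 * k \<le> 2 * M + 7"
    and "\<And>I ys g. state E I ys g \<Longrightarrow> I \<subseteq> V \<Longrightarrow> length ys < k"
    and "D \<subseteq> V" "state E D xs f"
  shows "good E M D"
proof -
  have "finite D" using assms(2,7) finite_subset by blast
  then show ?thesis using assms(7,8)
  proof (induction D arbitrary: xs f rule: finite_psubset_induct)
    case (psubset D)
    show ?case
    proof (rule ccontr)
      assume bad: "\<not> good E M D"
      interpret bad_state E V k M D xs f
        using assms psubset bad by unfold_locales blast+
      obtain ys R H where "link ys R H" "\<And>ys' R' H'. link ys' R' H' \<Longrightarrow> card H' \<le> card H"
        using link_max by blast
      then interpret max_link E V k M D xs f ys R H by unfold_locales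
      show False by (rule contradiction)
    qed
  qed
qed

section \<open>Minors from branch sets\<close>

text \<open>Arcs are pairs of vertices, so the vertex bijection \<open>g\<close> determines the arc
  map \<open>map_prod g g\<close>.\<close>

lemma pair_digraph_isoI:
  assumes "inj_on g (pverts K)" "pverts H = g ` pverts K" "parcs H = map_prod g g ` parcs K"
    "parcs K \<subseteq> pverts K \<times> pverts K"
  shows "digraph_iso (with_proj K) (with_proj H)"
proof -
  let ?f = "\<lparr> iso_verts = g, iso_arcs = map_prod g g, iso_head = snd, iso_tail = fst \<rparr>"
  have "wf_digraph (with_proj K)" using assms(4) by unfold_locales auto
  moreover have "inj_on (map_prod g g) (parcs K)"
    using map_prod_inj_on[OF assms(1,1)] assms(4) by (rule inj_on_subset)
  ultimately have "pre_digraph.digraph_isomorphism (with_proj K) ?f"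
    using assms(1) by (auto simp: pre_digraph.digraph_isomorphism_def)
  moreover have "with_proj H = app_iso ?f (with_proj K)"
    using assms(2,3) by (simp add: app_iso_def with_proj_def)
  ultimately show ?thesis by (auto simp: digraph_iso_def)
qed

lemma digraph_iso_card_verts: "digraph_iso G H \<Longrightarrow> card (verts G) = card (verts H)"
  by (auto simp: digraph_iso_def pre_digraph.digraph_isomorphism_def card_image)

lemma has_minor_step: "minor_step G G' \<Longrightarrow> has_minor G' H \<Longrightarrow> has_minor G H"
  unfolding has_minor_def by (meson converse_rtranclp_into_rtranclp)

lemma conn_cong: "Restr E A = Restr E' A \<Longrightarrow> conn E A \<longleftrightarrow> conn E' A"
  by (simp add: conn_def)

lemma sym_map_prod: "sym E \<Longrightarrow> sym (map_prod r r ` E)"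
  unfolding sym_def by force

lemma map_prod_subset: "E \<subseteq> V \<times> V \<Longrightarrow> (\<And>x. x \<in> V \<Longrightarrow> r x \<in> W) \<Longrightarrow> map_prod r r ` E \<subseteq> W \<times> W"
  by auto

text \<open>These are the conditions of \<open>pair_graph\<close> apart from loop-freeness, see
  \<open>pair_graph_iff\<close>. They form the invariant carried along minor steps.\<close>

definition simple_arcs :: "'a pair_pre_digraph \<Rightarrow> bool" where
  "simple_arcs G \<longleftrightarrow> finite (pverts G) \<and> sym (parcs G) \<and> parcs G \<subseteq> pverts G \<times> pverts G"

definition minor_model :: "'a pair_pre_digraph \<Rightarrow> 'b pair_pre_digraph \<Rightarrow> ('b \<Rightarrow> 'a set) \<Rightarrow> bool" where
  "minor_model G H \<phi> \<longleftrightarrow>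
     (\<forall>h\<in>pverts H. \<phi> h \<subseteq> pverts G \<and> conn (parcs G) (\<phi> h)) \<and>
     (\<forall>h\<in>pverts H. \<forall>h'\<in>pverts H. h \<noteq> h' \<longrightarrow> \<phi> h \<inter> \<phi> h' = {}) \<and>
     (\<forall>(x, y)\<in>parcs H. \<exists>u\<in>\<phi> x. \<exists>v\<in>\<phi> y. (u, v) \<in> parcs G)"

lemma minor_modelD:
  assumes "minor_model G H \<phi>"
  shows "h \<in> pverts H \<Longrightarrow> \<phi> h \<subseteq> pverts G" "h \<in> pverts H \<Longrightarrow> conn (parcs G) (\<phi> h)"
    and "h \<in> pverts H \<Longrightarrow> h' \<in> pverts H \<Longrightarrow> h \<noteq> h' \<Longrightarrow> \<phi> h \<inter> \<phi> h' = {}"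
    and "(x, y) \<in> parcs H \<Longrightarrow> \<exists>u\<in>\<phi> x. \<exists>v\<in>\<phi> y. (u, v) \<in> parcs G"
  using assms unfolding minor_model_def by blast+

lemma simple_arcs_finite: "simple_arcs G \<Longrightarrow> finite (parcs G)"
  unfolding simple_arcs_def by (meson finite_SigmaI finite_subset)

text \<open>Walks are mapped along \<open>r\<close>; a step across the contracted edge becomes
  stationary, so losing its arcs does no harm.\<close>

lemma conn_contract:
  fixes u v :: 'a
  assumes "conn E A"
  defines "r \<equiv> id(v := u)"
  shows "conn (map_prod r r ` (E - {(u, v), (v, u)})) (r ` A)"
proof -
  let ?E = "map_prod r r ` (E - {(u, v), (v, u)})"
  have "(r a, r b) \<in> (Restr ?E (r ` A))\<^sup>*" if "a \<in> A" "(a, b) \<in> (Restr E A)\<^sup>*" for a b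
    using that(2)
  proof (induction rule: rtrancl_induct)
    case (step y z)
    show ?case
    proof (cases "(y, z) \<in> {(u, v), (v, u)}")
      case True
      then have "r y = r z" by (auto simp: r_def)
      then show ?thesis using step by simp
    next
      case False
      then have "(r y, r z) \<in> Restr ?E (r ` A)" using step by force
      then show ?thesis using step by (meson rtrancl.rtrancl_into_rtrancl)
    qed
  qed auto
  then show ?thesis using assms(1) by (auto simp: conn_def)
qed

lemma minor_modelI:
  assumes "\<And>h. h \<in> pverts H \<Longrightarrow> \<phi> h \<subseteq> pverts G" "\<And>h. h \<in> pverts H \<Longrightarrow> conn (parcs G) (\<phi> h)"
    and "\<And>h h'. h \<in> pverts H \<Longrightarrow> h' \<in> pverts H \<Longrightarrow> h \<noteq> h' \<Longrightarrow> \<phi> h \<inter> \<phi> h' = {}"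
    and "\<And>x y. (x, y) \<in> parcs H \<Longrightarrow> \<exists>u\<in>\<phi> x. \<exists>v\<in>\<phi> y. (u, v) \<in> parcs G"
  shows "minor_model G H \<phi>"
  using assms unfolding minor_model_def by blast

lemma minor_model_delete_vertex:
  assumes "minor_model G H \<phi>" "\<And>h. h \<in> pverts H \<Longrightarrow> v \<notin> \<phi> h" "parcs H \<subseteq> pverts H \<times> pverts H"
  shows "minor_model \<lparr> pverts = pverts G - {v}, parcs = {(x, y) \<in> parcs G. x \<noteq> v \<and> y \<noteq> v} \<rparr> H \<phi>"
    (is "minor_model ?G H \<phi>")
proof (rule minor_modelI)
  fix h assume h: "h \<in> pverts H"
  show "\<phi> h \<subseteq> pverts ?G" using minor_modelD(1)[OF assms(1) h] assms(2)[OF h] by auto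
  have "Restr (parcs G) (\<phi> h) = Restr (parcs ?G) (\<phi> h)"
    using assms(2)[OF h] by auto
  then show "conn (parcs ?G) (\<phi> h)"
    using conn_cong minor_modelD(2)[OF assms(1) h] by blast
next
  fix x y assume xy: "(x, y) \<in> parcs H"
  then have "x \<in> pverts H" "y \<in> pverts H" using assms(3) by auto
  then show "\<exists>u\<in>\<phi> x. \<exists>w\<in>\<phi> y. (u, w) \<in> parcs ?G"
    using minor_modelD(4)[OF assms(1) xy] assms(2) by fastforce
qed (rule minor_modelD(3)[OF assms(1)])

text \<open>Both \<open>u\<close> and \<open>v\<close> belong to the single branch set
  \<open>\<phi> h0\<close>, so renaming \<open>v\<close> to \<open>u\<close> keeps the branch sets
  disjoint and the removed arcs join no two different branch sets.\<close>

lemma minor_model_contract: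
  fixes u v :: 'a
  assumes "minor_model G H \<phi>" "h0 \<in> pverts H" "u \<in> \<phi> h0" "v \<in> \<phi> h0" "u \<noteq> v"
    "parcs H \<subseteq> pverts H \<times> pverts H" "irrefl (parcs H)"
  defines "r \<equiv> id(v := u)"
  shows "minor_model \<lparr> pverts = pverts G - {v},
      parcs = map_prod r r ` (parcs G - {(u, v), (v, u)}) \<rparr> H (\<lambda>h. r ` \<phi> h)"
    (is "minor_model ?G H _")
proof (rule minor_modelI)
  have u: "u \<in> pverts G" using minor_modelD(1)[OF assms(1,2)] assms(3) by auto
  fix h assume h: "h \<in> pverts H"
  show "r ` \<phi> h \<subseteq> pverts ?G"
    using minor_modelD(1)[OF assms(1) h] u assms(5) by (auto simp: r_def)
  show "conn (parcs ?G) (r ` \<phi> h)"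
    unfolding r_def pair_pre_digraph.select_convs by (rule conn_contract[OF minor_modelD(2)[OF assms(1) h]])
next
  fix h h' assume h: "h \<in> pverts H" "h' \<in> pverts H" "h \<noteq> h'"
  have D: "\<phi> h \<inter> \<phi> h' = {}" using minor_modelD(3)[OF assms(1) h] .
  have "a = h0" if "a \<in> pverts H" "u \<in> \<phi> a \<or> v \<in> \<phi> a" for a
    using minor_modelD(3)[OF assms(1,2) that(1)] that(2) assms(3,4) by blast
  then have "\<not> (u \<in> \<phi> h \<and> v \<in> \<phi> h')" "\<not> (u \<in> \<phi> h' \<and> v \<in> \<phi> h)" using h by metis+
  then show "r ` \<phi> h \<inter> r ` \<phi> h' = {}" using D unfolding r_def by (auto split: if_splits)
next
  fix x y assume xy: "(x, y) \<in> parcs H"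
  then have h: "x \<in> pverts H" "y \<in> pverts H" "x \<noteq> y" using assms(6,7) by (auto simp: irrefl_def)
  obtain p q where pq: "p \<in> \<phi> x" "q \<in> \<phi> y" "(p, q) \<in> parcs G"
    using minor_modelD(4)[OF assms(1) xy] by blast
  have "a = h0" if "a \<in> pverts H" "u \<in> \<phi> a \<or> v \<in> \<phi> a" for a
    using minor_modelD(3)[OF assms(1,2) that(1)] that(2) assms(3,4) by blast
  then have "(p, q) \<noteq> (u, v)" "(p, q) \<noteq> (v, u)" using h pq by blast+
  then have "(r p, r q) \<in> parcs ?G" using pq(3) by (auto intro!: image_eqI[of _ _ "(p, q)"])
  then show "\<exists>p\<in>r ` \<phi> x. \<exists>q\<in>r ` \<phi> y. (p, q) \<in> parcs ?G" using pq by blast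
qed

text \<open>Induction on the number of vertices and arcs: delete a vertex outside all branch sets,
  else contract an edge inside a branch set, else delete an arc pair that \<open>H\<close> lacks.
  When none applies, \<open>G\<close> is isomorphic to \<open>H\<close>.\<close>

lemma minor_model_imp_has_minor:
  assumes "simple_arcs G" "minor_model G H \<phi>" "simple_arcs H" "irrefl (parcs H)"
  shows "has_minor G H"
  using assms(1,2)
proof (induction "card (pverts G) + card (parcs G)" arbitrary: G \<phi> rule: less_induct)
  case less
  have G: "finite (pverts G)" "sym (parcs G)" "parcs G \<subseteq> pverts G \<times> pverts G" "finite (parcs G)"
    using less.prems(1) simple_arcs_finite by (auto simp: simple_arcs_def)
  have H: "parcs H \<subseteq> pverts H \<times> pverts H" "sym (parcs H)" using assms(3) by (auto simp: simple_arcs_def)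
  note M = minor_modelD[OF less.prems(2)]
  have smaller: ?case if "minor_step G G'" "card (pverts G') + card (parcs G') < card (pverts G) + card (parcs G)"
    "simple_arcs G'" "minor_model G' H \<phi>'" for G' \<phi>'
    using has_minor_step[OF that(1)] less.hyps[OF that(2-4)] by blast
  consider (del) v where "v \<in> pverts G" "\<And>h. h \<in> pverts H \<Longrightarrow> v \<notin> \<phi> h"
    | (con) h u v where "h \<in> pverts H" "u \<in> \<phi> h" "v \<in> \<phi> h" "u \<noteq> v"
    | (sing) "\<And>v. v \<in> pverts G \<Longrightarrow> \<exists>h\<in>pverts H. v \<in> \<phi> h"
        "\<And>h u v. h \<in> pverts H \<Longrightarrow> u \<in> \<phi> h \<Longrightarrow> v \<in> \<phi> h \<Longrightarrow> u = v"
    by blast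
  then show ?case
  proof cases
    case del
    let ?G = "\<lparr> pverts = pverts G - {v}, parcs = {(x, y) \<in> parcs G. x \<noteq> v \<and> y \<noteq> v} \<rparr>"
    show ?thesis
    proof (rule smaller[OF minor_step.delete_vertex[OF del(1)]])
      have "card (pverts ?G) < card (pverts G)" using card_Diff1_less[OF G(1) del(1)] by simp
      moreover have "card (parcs ?G) \<le> card (parcs G)" using G(4) by (auto intro!: card_mono)
      ultimately show "card (pverts ?G) + card (parcs ?G) < card (pverts G) + card (parcs G)" by simp
      show "simple_arcs ?G" using G by (auto simp: simple_arcs_def sym_def)
      show "minor_model ?G H \<phi>" by (rule minor_model_delete_vertex[OF less.prems(2) del(2) H(1)])
    qed
  next
    case con
    have "conn (parcs G) (\<phi> h)" using M(2) con(1) .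
    \<comment> \<open>The given \<open>u\<close> and \<open>v\<close> need not be adjacent;
      connectivity yields an arc from \<open>u\<close> within the branch set, and its end
      \<open>b\<close> is contracted instead.\<close>
    then obtain a b where ab: "b \<in> \<phi> h" "a = u" "b \<noteq> u" "(a, b) \<in> parcs G"
      using conn_exit[of "parcs G" "\<phi> h" "{u}"] con by blast
    let ?r = "id(b := u)"
    let ?G = "\<lparr> pverts = pverts G - {b}, parcs = map_prod ?r ?r ` (parcs G - {(u, b), (b, u)}) \<rparr>"
    show ?thesis
    proof (rule smaller)
      show "minor_step G ?G" using ab by (intro minor_step.contract_edge) auto
      have b: "b \<in> pverts G" using ab G(3) by auto
      then have "card (pverts ?G) < card (pverts G)"
        using card_Diff1_less[OF G(1)] by simp
      moreover have "card (parcs ?G) \<le> card (parcs G - {(u, b), (b, u)})"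
        using G(4) by (simp add: card_image_le)
      moreover have "card (parcs G - {(u, b), (b, u)}) \<le> card (parcs G)"
        using G(4) by (intro card_mono) auto
      ultimately show "card (pverts ?G) + card (parcs ?G) < card (pverts G) + card (parcs G)" by linarith
      have "u \<in> pverts G" using ab G(3) by auto
      have "sym (parcs G - {(u, b), (b, u)})" using G(2) by (auto simp: sym_def)
      then have "sym (parcs ?G)" by (simp add: sym_map_prod)
      moreover have "\<And>x. x \<in> pverts G \<Longrightarrow> ?r x \<in> pverts G - {b}"
        using \<open>u \<in> pverts G\<close> ab(3) by auto
      then have "parcs ?G \<subseteq> pverts ?G \<times> pverts ?G"
        using map_prod_subset[of "parcs G - {(u, b), (b, u)}" "pverts G" ?r "pverts G - {b}"] G(3) by auto
      ultimately show "simple_arcs ?G" using G(1) by (simp add: simple_arcs_def)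
      show "minor_model ?G H (\<lambda>h. ?r ` \<phi> h)"
        using minor_model_contract[OF less.prems(2) con(1,2) ab(1) _ H(1) assms(4)] ab(3) by simp
    qed
  next
    case sing
    define g where "g h = (SOME v. v \<in> \<phi> h)" for h
    have g: "\<phi> h = {g h}" if "h \<in> pverts H" for h
    proof -
      have "\<phi> h \<noteq> {}" using conn_nonempty[OF M(2)[OF that]] .
      then have "g h \<in> \<phi> h" unfolding g_def by (simp add: some_in_eq)
      then show ?thesis using sing(2)[OF that] by auto
    qed
    have gverts: "g ` pverts H = pverts G" using sing(1) M(1) g by fastforce
    have ginj: "inj_on g (pverts H)"
      by (rule inj_onI) (use M(3) g in fastforce)
    have garcs: "map_prod g g ` parcs H \<subseteq> parcs G"
    proof clarsimp
      fix x y assume xy: "(x, y) \<in> parcs H"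
      then show "(g x, g y) \<in> parcs G" using M(4)[OF xy] g H(1) by auto
    qed
    show ?thesis
    proof (cases "parcs G \<subseteq> map_prod g g ` parcs H")
      case True
      then have "digraph_iso (with_proj H) (with_proj G)"
        using ginj gverts garcs H(1) by (intro pair_digraph_isoI[of g]) auto
      moreover have "wf_digraph (with_proj H)" using H(1) by unfold_locales auto
      ultimately have "digraph_iso (with_proj G) (with_proj H)" using digraph_iso_swap by blast
      then show ?thesis unfolding has_minor_def by blast
    next
      case False
      then obtain u v where uv: "(u, v) \<in> parcs G" "(u, v) \<notin> map_prod g g ` parcs H" by auto
      let ?G = "\<lparr> pverts = pverts G, parcs = parcs G - {(u, v), (v, u)} \<rparr>"
      have "(v, u) \<notin> map_prod g g ` parcs H"
        using symD[OF sym_map_prod[OF H(2), of g], of v u] uv(2) by argo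
      show ?thesis
      proof (rule smaller[OF minor_step.delete_edge[OF uv(1)]])
        show "card (pverts ?G) + card (parcs ?G) < card (pverts G) + card (parcs G)"
          using uv(1) G(4) by (auto intro!: psubset_card_mono)
        show "simple_arcs ?G" using G by (auto simp: simple_arcs_def sym_def)
        have "(g x, g y) \<in> parcs G - {(u, v), (v, u)}" if "(x, y) \<in> parcs H" for x y
        proof -
          have im: "(g x, g y) \<in> map_prod g g ` parcs H" using that by (intro image_eqI[of _ _ "(x, y)"]) auto
          then have "(g x, g y) \<in> parcs G" using garcs by (rule subsetD[rotated])
          moreover have "(g x, g y) \<noteq> (u, v)" "(g x, g y) \<noteq> (v, u)"
            using im uv(2) \<open>(v, u) \<notin> _\<close> by metis+
          ultimately show ?thesis by simp
        qed
        moreover have "x \<in> pverts H \<and> y \<in> pverts H" if "(x, y) \<in> parcs H" for x y using that H(1) by auto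
        ultimately show "minor_model ?G H \<phi>"
          using M(1,3) g unfolding minor_model_def by (auto simp del: Diff_iff)
      qed
    qed
  qed
qed

section \<open>The wheel minor of a long state\<close>

lemma wheel_verts: "pverts (wheel_graph k) = {..k}"
  by (auto simp: wheel_graph_def cycle_graph_def)

lemma wheel_simple:
  assumes "3 \<le> k"
  shows "simple_arcs (wheel_graph k)" "irrefl (parcs (wheel_graph k))"
proof -
  have "Suc i mod k \<noteq> i" if "i < k" for i
    using assms that by (cases "Suc i = k") auto
  then show "irrefl (parcs (wheel_graph k))"
    using assms unfolding wheel_graph_def cycle_graph_def irrefl_def by (auto dest: sym)
  show "simple_arcs (wheel_graph k)"
    using assms by (auto simp: wheel_graph_def cycle_graph_def simple_arcs_def sym_def
        intro: less_imp_le)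
qed

lemma conn_subset_verts:
  assumes "conn E A" "E \<subseteq> V \<times> V" "A \<inter> V \<noteq> {}"
  shows "A \<subseteq> V"
  using conn_exit[OF assms(1,3)] assms(2) by blast

lemma conn_chain:
  assumes "sym E" "\<And>j. a \<le> j \<Longrightarrow> j \<le> b \<Longrightarrow> conn E (F j)"
    "\<And>j. a \<le> j \<Longrightarrow> j < b \<Longrightarrow> \<exists>u\<in>F j. \<exists>v\<in>F (Suc j). (u, v) \<in> E" "a \<le> b"
  shows "conn E (\<Union>j\<in>{a..b}. F j)"
  using assms(4,2,3)
proof (induction b rule: dec_induct)
  case (step n)
  obtain u v where uv: "u \<in> F n" "v \<in> F (Suc n)" "(u, v) \<in> E" using step by blast
  have "conn E ((\<Union>j\<in>{a..n}. F j) \<union> F (Suc n))"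
  proof (rule conn_Un_edge[OF assms(1) _ _ _ uv(2,3)])
    show "conn E (\<Union>j\<in>{a..n}. F j)" using step by simp
    show "conn E (F (Suc n))" using step by simp
    show "u \<in> (\<Union>j\<in>{a..n}. F j)" using uv step by auto
  qed
  moreover have "(\<Union>j\<in>{a..n}. F j) \<union> F (Suc n) = (\<Union>j\<in>{a..Suc n}. F j)"
    using step by (auto simp: atLeastAtMostSuc_conv)
  ultimately show ?case by simp
qed simp

text \<open>The set \<open>D\<close> is the hub and the first \<open>k - 1\<close> branch sets are
  rim vertices. All remaining branch sets are united into the last rim vertex, so a state longer
  than \<open>k\<close> still gives exactly a \<open>k\<close>-wheel.\<close>

lemma state_wheel_minor:
  assumes G: "simple_arcs G" and st: "state (parcs G) D xs f" "D \<subseteq> pverts G"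
    and k: "3 \<le> k" "k \<le> length xs"
  shows "has_minor G (wheel_graph k)"
proof -
  let ?E = "parcs G"
  let ?n = "length xs"
  have E: "sym ?E" "?E \<subseteq> pverts G \<times> pverts G" using G by (auto simp: simple_arcs_def)
  have S: "distinct xs" "set xs = nbh ?E D" "cyc (touch ?E f) xs" "conn ?E D"
    "\<And>x. x \<in> set xs \<Longrightarrow> x \<in> f x \<and> conn ?E (f x) \<and> f x \<inter> D = {}"
    "\<And>x y. x \<in> set xs \<Longrightarrow> y \<in> set xs \<Longrightarrow> x \<noteq> y \<Longrightarrow> f x \<inter> f y = {}"
    using st(1) unfolding state_def weak_state_def by blast+
  have ne: "xs \<noteq> []" using k by auto
  have succ: "successively (touch ?E f) xs" "touch ?E f (last xs) (hd xs)"
    using S(3) ne by (auto simp: cyc_def successively_append_iff)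
  define F where "F j = f (xs ! j)" for j
  have dist: "F i \<inter> F j = {}" if "i < ?n" "j < ?n" "i \<noteq> j" for i j
    using S(6)[of "xs ! i" "xs ! j"] S(1) that by (auto simp: F_def nth_eq_iff_index_eq)
  have Fc: "conn ?E (F j)" "F j \<inter> D = {}" "xs ! j \<in> F j" "xs ! j \<in> nbh ?E D" if "j < ?n" for j
    using S(5)[OF nth_mem[OF that]] nth_mem[OF that] unfolding F_def S(2) by blast+
  have step: "\<exists>u\<in>F j. \<exists>v\<in>F (Suc j). (u, v) \<in> ?E" if "Suc j < ?n" for j
  proof -
    have "touch ?E f (xs ! j) (xs ! Suc j)" using succ(1) that by (simp add: successively_conv_nth)
    moreover have "xs ! j \<noteq> xs ! Suc j" using S(1) that by (simp add: nth_eq_iff_index_eq)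
    ultimately show ?thesis by (auto simp: touch_def F_def)
  qed
  have close: "\<exists>u\<in>F (?n - 1). \<exists>v\<in>F 0. (u, v) \<in> ?E"
  proof -
    have "touch ?E f (xs ! (?n - 1)) (xs ! 0)" using succ(2) ne by (simp add: last_conv_nth hd_conv_nth)
    moreover have "xs ! (?n - 1) \<noteq> xs ! 0" using S(1) k by (subst nth_eq_iff_index_eq) auto
    ultimately show ?thesis by (auto simp: touch_def F_def)
  qed
  define \<phi> where "\<phi> i = (if i = k then D else if i = k - 1 then (\<Union>j\<in>{k - 1..?n - 1}. F j) else F i)" for i
  have FV: "F j \<subseteq> pverts G" if "j < ?n" for j
  proof (rule conn_subset_verts[OF Fc(1)[OF that] E(2)])
    show "F j \<inter> pverts G \<noteq> {}" using Fc(3,4)[OF that] E(2) by (auto simp: nbh_def)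
  qed
  have lt: "l < ?n" if "l \<in> {i..?n - 1}" for i l
    using that k unfolding atLeastAtMost_iff by linarith
  \<comment> \<open>This uniform bound treats the united rim vertex like the others in the inclusion
    and disjointness arguments.\<close>
  have sub: "\<phi> i \<subseteq> (\<Union>l\<in>{i..?n - 1}. F l)" if "i < k" for i
  proof (cases "i = k - 1")
    case False
    then have "i \<in> {i..?n - 1}" using that k by auto
    then show ?thesis using False that unfolding \<phi>_def by auto
  qed (use that in \<open>simp add: \<phi>_def\<close>)
  have hub: "\<exists>u\<in>D. \<exists>v\<in>\<phi> i. (u, v) \<in> ?E" if "i < k" for i
  proof -
    have "xs ! i \<in> \<phi> i" using that k Fc(3)[of i] by (auto simp: \<phi>_def)
    then show ?thesis using Fc(4)[of i] that k by (auto simp: nbh_def)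
  qed
  have rim: "\<exists>u\<in>\<phi> i. \<exists>v\<in>\<phi> ((i + 1) mod k). (u, v) \<in> ?E" if i: "i < k" for i
  proof (cases "i = k - 1")
    case True
    have 0: "\<phi> ((i + 1) mod k) = F 0" using True k by (auto simp: \<phi>_def)
    have "?n - 1 \<in> {k - 1..?n - 1}" "i \<noteq> k" using True k by auto
    then have "F (?n - 1) \<subseteq> \<phi> i" using True unfolding \<phi>_def by auto
    then show ?thesis using close 0 by blast
  next
    case False
    then have "(i + 1) mod k = Suc i" using i by auto
    moreover have "F (Suc i) \<subseteq> \<phi> (Suc i)"
    proof (cases "Suc i = k - 1")
      case True
      then have "Suc i \<in> {k - 1..?n - 1}" using k by auto
      then show ?thesis using True False i unfolding \<phi>_def by auto
    qed (use False i in \<open>auto simp: \<phi>_def\<close>)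
    moreover have "\<phi> i = F i" using False i by (auto simp: \<phi>_def)
    ultimately show ?thesis using step[of i] i k False by fastforce
  qed
  have "minor_model G (wheel_graph k) \<phi>"
    unfolding minor_model_def
  proof (intro conjI ballI impI)
    fix i assume i: "i \<in> pverts (wheel_graph k)"
    show "\<phi> i \<subseteq> pverts G"
    proof (cases "i = k")
      case False
      then have "\<phi> i \<subseteq> (\<Union>l\<in>{i..?n - 1}. F l)" using sub i by (simp add: wheel_verts)
      moreover have "F l \<subseteq> pverts G" if "l \<in> {i..?n - 1}" for l
        using FV lt[OF that] .
      ultimately show ?thesis by blast
    qed (use st(2) in \<open>simp add: \<phi>_def\<close>)
    have "conn ?E (\<Union>j\<in>{k - 1..?n - 1}. F j)"
      by (rule conn_chain[OF E(1)]) (use Fc(1) step k in auto)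
    then show "conn ?E (\<phi> i)" using S(4) Fc(1) i k by (auto simp: \<phi>_def wheel_verts)
  next
    fix i j assume ij: "i \<in> pverts (wheel_graph k)" "j \<in> pverts (wheel_graph k)" "i \<noteq> j"
    have disj: "\<phi> i \<inter> \<phi> j = {}" if "i < j" "j \<le> k" for i j
    proof (cases "j = k")
      case True
      have "F l \<inter> D = {}" if "l \<in> {i..?n - 1}" for l using Fc(2) lt[OF that] .
      then have "\<phi> i \<inter> D = {}" using sub[of i] that(1) True by blast
      then show ?thesis using True by (simp add: \<phi>_def)
    next
      case False
      then have 1: "\<phi> i = F i" using that by (auto simp: \<phi>_def)
      have 2: "\<phi> j \<subseteq> (\<Union>l\<in>{j..?n - 1}. F l)" using False that by (intro sub) auto
      have "F i \<inter> F l = {}" if "l \<in> {j..?n - 1}" for l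
        using dist[of i l] lt[OF that] that \<open>i < j\<close> by auto
      then show ?thesis using 1 2 by blast
    qed
    show "\<phi> i \<inter> \<phi> j = {}"
      using disj[of i j] disj[of j i] ij by (cases "i < j") (auto simp: wheel_verts)
  next
    fix e assume "e \<in> parcs (wheel_graph k)"
    then consider i where "i < k" "e = (i, (i + 1) mod k) \<or> e = ((i + 1) mod k, i)"
      | i where "i < k" "e = (k, i) \<or> e = (i, k)"
      by (auto simp: wheel_graph_def cycle_graph_def)
    then show "case e of (x, y) \<Rightarrow> \<exists>u\<in>\<phi> x. \<exists>v\<in>\<phi> y. (u, v) \<in> ?E"
    proof cases
      case 1
      then show ?thesis using rim[OF 1(1)] symD[OF E(1)] by fastforce
    next
      case 2
      have "\<phi> k = D" by (simp add: \<phi>_def)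
      then show ?thesis using 2 hub[OF 2(1)] symD[OF E(1)] by fastforce
    qed
  qed
  then show ?thesis using minor_model_imp_has_minor[OF G] wheel_simple[OF k(1)] by blast
qed

section \<open>Trees\<close>

lemma rtrancl_on_Restr: "(u, v) \<in> rtrancl_on A r \<longleftrightarrow> u \<in> A \<and> (u, v) \<in> (Restr r A)\<^sup>*"
proof
  assume "(u, v) \<in> rtrancl_on A r"
  then show "u \<in> A \<and> (u, v) \<in> (Restr r A)\<^sup>*"
  proof (induction rule: rtrancl_on.induct)
    case (rtrancl_on_into_rtrancl_on a b c)
    then have "b \<in> A" by (auto elim: rtranclE)
    then have "(b, c) \<in> Restr r A" using rtrancl_on_into_rtrancl_on by auto
    then show ?case using rtrancl_on_into_rtrancl_on by (meson rtrancl.rtrancl_into_rtrancl)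
  qed auto
next
  assume uv: "u \<in> A \<and> (u, v) \<in> (Restr r A)\<^sup>*"
  then have "(u, v) \<in> (Restr r A)\<^sup>*" by simp
  then show "(u, v) \<in> rtrancl_on A r"
  proof (induction rule: rtrancl_induct)
    case base then show ?case using uv by auto
  next
    case (step y z)
    then show ?case by (auto intro: rtrancl_on_into_rtrancl_on)
  qed
qed

lemma connected_induce_iff:
  assumes "sym (parcs T)"
  shows "Digraph_Component.connected (with_proj T \<restriction> A) \<longleftrightarrow> conn (parcs T) A"
proof -
  have ends: "arcs_ends (with_proj T \<restriction> A) = Restr (parcs T) A"
    by (auto simp: arcs_ends_conv induce_subgraph_def)
  have verts: "verts (with_proj T \<restriction> A) = A" by (simp add: induce_subgraph_def)
  have "sym (Restr (parcs T) A)" using assms by (auto simp: sym_def)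
  then have symcl: "(Restr (parcs T) A)\<^sup>s = Restr (parcs T) A"
    by (auto simp: symcl_def sym_def)
  interpret wf_digraph "with_proj T \<restriction> A"
    by unfold_locales (auto simp: induce_subgraph_def)
  have "Restr (Restr (parcs T) A) A = Restr (parcs T) A" by auto
  then show ?thesis
    unfolding connected_conv verts ends symcl rtrancl_on_Restr conn_def by auto
qed

lemma connected_iff:
  assumes "sym (parcs T)" "parcs T \<subseteq> pverts T \<times> pverts T"
  shows "Digraph_Component.connected (with_proj T) \<longleftrightarrow> conn (parcs T) (pverts T)"
proof -
  have "with_proj T \<restriction> pverts T = with_proj T"
    using assms(2) by (auto simp: induce_subgraph_def with_proj_def)
  then show ?thesis using connected_induce_iff[OF assms(1), of "pverts T"] by simp
qed

text \<open>An undirected cycle as a list of its vertices, without repetition of the starting point;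
  the length bound excludes going back and forth along one edge.\<close>

definition vcycle :: "'a rel \<Rightarrow> 'a list \<Rightarrow> bool" where
  "vcycle E vs \<longleftrightarrow> distinct vs \<and> 3 \<le> length vs \<and> cyc (\<lambda>x y. (x, y) \<in> E) vs"

lemma pcas_successively:
  assumes "pcas u p v" "set p \<subseteq> A"
  shows "successively (\<lambda>x y. (x, y) \<in> A) (pawalk_verts u p) \<and> hd (pawalk_verts u p) = u \<and>
    last (pawalk_verts u p) = v \<and> length (pawalk_verts u p) = Suc (length p)"
  using assms
proof (induction p arbitrary: u)
  case (Cons e p)
  then have IH: "successively (\<lambda>x y. (x, y) \<in> A) (pawalk_verts (snd e) p)"
    "hd (pawalk_verts (snd e) p) = snd e" "last (pawalk_verts (snd e) p) = v"
    "length (pawalk_verts (snd e) p) = Suc (length p)" by auto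
  then have ne: "pawalk_verts (snd e) p \<noteq> []" by auto
  have "(u, snd e) \<in> A" using Cons.prems by (cases e) auto
  then show ?case using IH ne Cons.prems by (auto simp: successively_Cons)
qed auto

lemma successively_pcas:
  assumes "successively (\<lambda>x y. (x, y) \<in> A) w" "w \<noteq> []"
  shows "\<exists>p. set p \<subseteq> A \<and> pcas (hd w) p (last w) \<and> pawalk_verts (hd w) p = w"
  using assms
proof (induction w rule: induct_list012)
  case (2 x)
  then show ?case by (intro exI[of _ "[]"]) auto
next
  case (3 x y zs)
  then obtain p where "set p \<subseteq> A" "pcas y p (last (y # zs))" "pawalk_verts y p = y # zs" by auto
  then show ?case using 3 by (intro exI[of _ "(x, y) # p"]) auto
qed simp

lemma cycle_iff_vcycle:
  assumes "parcs T \<subseteq> pverts T \<times> pverts T"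
  shows "(\<exists>p. pre_digraph.cycle (with_proj T) p \<and> 3 \<le> length p) \<longleftrightarrow> (\<exists>vs. vcycle (parcs T) vs)"
proof
  assume "\<exists>p. pre_digraph.cycle (with_proj T) p \<and> 3 \<le> length p"
  then obtain p u where p: "set p \<subseteq> parcs T" "pcas u p u" "distinct (tl (pawalk_verts u p))" "3 \<le> length p"
    unfolding pre_digraph.cycle_def pre_digraph.awalk_def cas_with_proj_eq awalk_verts_with_proj_eq
    by auto
  note w = pcas_successively[OF p(2,1)]
  obtain vs where vs: "pawalk_verts u p = u # vs" using w by (cases "pawalk_verts u p") auto
  then have len: "length vs = length p" using w by simp
  then have "vs \<noteq> []" using p(4) by auto
  moreover from this have "last vs = u" using w vs by simp
  ultimately have "vcycle (parcs T) vs" using vs w len p(3,4)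
    by (auto simp: vcycle_def cyc_def successively_Cons successively_append_iff)
  then show "\<exists>vs. vcycle (parcs T) vs" by blast
next
  assume "\<exists>vs. vcycle (parcs T) vs"
  then obtain vs where vs: "distinct vs" "3 \<le> length vs" "cyc (\<lambda>x y. (x, y) \<in> parcs T) vs"
    by (auto simp: vcycle_def)
  then have ne: "vs \<noteq> []" by auto
  \<comment> \<open>The library requires distinctness of the tail of the vertex list, so the closed
    walk starts at \<open>last vs\<close> and has \<open>vs\<close> as its tail.\<close>
  let ?w = "last vs # vs"
  have "successively (\<lambda>x y. (x, y) \<in> parcs T) ?w"
    using vs(3) ne by (auto simp: cyc_def successively_Cons successively_append_iff)
  then obtain p where p: "set p \<subseteq> parcs T" "pcas (last vs) p (last vs)" "pawalk_verts (last vs) p = ?w"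
    using successively_pcas[of "parcs T" ?w] ne by auto
  have "Suc (length p) = Suc (length vs)" using pcas_successively[OF p(2,1)] p(3) by simp
  then have "3 \<le> length p" using vs(2) by simp
  moreover have "(last vs, hd vs) \<in> parcs T" using vs(3) ne by (auto simp: cyc_def successively_append_iff)
  then have "last vs \<in> pverts T" using assms by auto
  ultimately show "\<exists>p. pre_digraph.cycle (with_proj T) p \<and> 3 \<le> length p"
    unfolding pre_digraph.cycle_def pre_digraph.awalk_def cas_with_proj_eq awalk_verts_with_proj_eq
    using p vs(1) by (intro exI[of _ p]) (auto intro!: exI[of _ "last vs"])
qed

lemma pair_graph_iff:
  "pair_graph G \<longleftrightarrow> simple_arcs G \<and> irrefl (parcs G)"
proof
  assume "pair_graph G"
  then interpret pair_graph G .
  have "sym (parcs G)" using arcs_symmetric by (auto simp: sym_def)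
  moreover have "irrefl (parcs G)" using pair_no_loops by (fastforce simp: irrefl_def)
  moreover have "parcs G \<subseteq> pverts G \<times> pverts G" using wellformed' by auto
  ultimately show "simple_arcs G \<and> irrefl (parcs G)"
    using pair_finite_verts by (simp add: simple_arcs_def)
next
  assume *: "simple_arcs G \<and> irrefl (parcs G)"
  then have "finite (parcs G)" using simple_arcs_finite by blast
  then show "pair_graph G"
    using * by unfold_locales (auto simp: simple_arcs_def irrefl_def Digraph.symmetric_def)
qed

lemma is_tree_iff:
  "is_tree T \<longleftrightarrow> simple_arcs T \<and> irrefl (parcs T) \<and> conn (parcs T) (pverts T) \<and>
     \<not> (\<exists>vs. vcycle (parcs T) vs)"
  unfolding is_tree_def pair_graph_iff
  using connected_iff[of T] cycle_iff_vcycle[of T] by (auto simp: simple_arcs_def)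

lemma conn_mono: "conn E A \<Longrightarrow> E \<subseteq> E' \<Longrightarrow> conn E' A"
  unfolding conn_def by (meson Int_mono order_refl rtrancl_mono subset_eq)

definition add_leaf :: "'a pair_pre_digraph \<Rightarrow> 'a \<Rightarrow> 'a \<Rightarrow> 'a pair_pre_digraph" where
  "add_leaf T t n = \<lparr> pverts = insert n (pverts T), parcs = parcs T \<union> {(n, t), (t, n)} \<rparr>"

text \<open>On a cycle through \<open>n\<close>, both neighbours of \<open>n\<close> would have to
  be \<open>t\<close>, but a cycle has at least two further distinct vertices.\<close>

lemma is_tree_add_leaf:
  assumes T: "is_tree T" and t: "t \<in> pverts T" and n: "n \<notin> pverts T"
  shows "is_tree (add_leaf T t n)"
proof -
  let ?E = "parcs T" and ?E' = "parcs T \<union> {(n, t), (t, n)}"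
  have T': "finite (pverts T)" "sym ?E" "?E \<subseteq> pverts T \<times> pverts T" "irrefl ?E" "conn ?E (pverts T)"
    "\<And>vs. \<not> vcycle ?E vs"
    using T by (auto simp: is_tree_iff simple_arcs_def)
  have nt: "n \<noteq> t" using t n by auto
  have sym': "sym ?E'" using T'(2) by (auto simp: sym_def)
  have "conn ?E' (pverts T \<union> {n})"
    by (rule conn_Un_edge[OF sym' conn_mono[OF T'(5)] conn_singleton t]) auto
  moreover have "\<not> vcycle ?E' vs" for vs
  proof
    assume vs: "vcycle ?E' vs"
    show False
    proof (cases "n \<in> set vs")
      case True
      then obtain m zs where rot: "rotate m vs = n # zs" using rotate_to by metis
      have "cyc (\<lambda>x y. (x, y) \<in> ?E') (n # zs)" "distinct (n # zs)" "3 \<le> length (n # zs)"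
        using vs cyc_rotate[of "\<lambda>x y. (x, y) \<in> ?E'" vs m] distinct_rotate[of m vs] length_rotate[of m vs]
        unfolding vcycle_def rot by simp_all
      moreover from this have "zs \<noteq> []" by auto
      ultimately have "(n, hd zs) \<in> ?E'" "(last zs, n) \<in> ?E'"
        by (auto simp: cyc_def successively_Cons successively_append_iff)
      moreover have "(n, x) \<notin> ?E" "(x, n) \<notin> ?E" for x using T'(3) n by auto
      ultimately have "hd zs = t" "last zs = t" using nt by auto
      moreover have "2 \<le> length zs" "distinct zs"
        using \<open>3 \<le> length (n # zs)\<close> \<open>distinct (n # zs)\<close> by auto
      ultimately obtain y l where "zs = t # y # l" "t \<notin> set (y # l)" "last (y # l) = t"
        by (cases zs rule: remdups_adj.cases) auto
      then show False using last_in_set[of "y # l"] by simp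
    next
      case False
      have ne: "vs \<noteq> []" using vs by (auto simp: vcycle_def)
      have "successively (\<lambda>x y. (x, y) \<in> ?E') (vs @ [hd vs])" using vs ne by (auto simp: vcycle_def cyc_def)
      then have "successively (\<lambda>x y. (x, y) \<in> ?E) (vs @ [hd vs])"
        by (rule successively_mono) (use False ne in auto)
      then have "vcycle ?E vs" using vs by (auto simp: vcycle_def cyc_def)
      then show False using T'(6) by blast
    qed
  qed
  ultimately show ?thesis
    using T'(1,3,4) sym' t nt
    by (auto simp: is_tree_iff add_leaf_def simple_arcs_def irrefl_def)
qed

section \<open>Tree decompositions from good sets\<close>

definition induced :: "'a pair_pre_digraph \<Rightarrow> 'a set \<Rightarrow> 'a pair_pre_digraph" where
  "induced G U = \<lparr> pverts = U, parcs = Restr (parcs G) U \<rparr>"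

lemma tree_decomposition_iff:
  "tree_decomposition G T X \<longleftrightarrow> is_tree T \<and> (\<Union>t\<in>pverts T. X t) = pverts G \<and>
     (\<forall>(u, v)\<in>parcs G. \<exists>t\<in>pverts T. u \<in> X t \<and> v \<in> X t) \<and>
     (\<forall>v\<in>pverts G. conn (parcs T) {t \<in> pverts T. v \<in> X t})"
proof -
  have "is_tree T \<Longrightarrow> sym (parcs T)" by (simp add: is_tree_iff simple_arcs_def)
  then show ?thesis unfolding tree_decomposition_def using connected_induce_iff by blast
qed

text \<open>The new bag is \<open>N \<union> S\<close>. Vertices of \<open>N\<close> already lie in
  the bag at \<open>t\<close>, so their subtrees stay connected, while those of \<open>S\<close>
  occur only at the leaf; \<open>edges\<close> puts every edge between \<open>S\<close> and
  \<open>U\<close> into the new bag.\<close>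

lemma tree_decomposition_add_leaf:
  assumes td: "tree_decomposition (induced G U) T X"
    and t: "t \<in> pverts T" "N \<subseteq> X t" and n: "n \<notin> pverts T"
    and G: "sym (parcs G)" and S: "S \<inter> U = {}"
    and edges: "\<And>s x. s \<in> S \<Longrightarrow> x \<in> U \<Longrightarrow> (s, x) \<in> parcs G \<Longrightarrow> x \<in> N"
  shows "tree_decomposition (induced G (U \<union> S)) (add_leaf T t n) (X(n := N \<union> S))"
proof -
  let ?T = "add_leaf T t n" and ?X = "X(n := N \<union> S)"
  have T: "is_tree T" "(\<Union>t\<in>pverts T. X t) = U"
    "\<And>u v. (u, v) \<in> parcs G \<Longrightarrow> u \<in> U \<Longrightarrow> v \<in> U \<Longrightarrow> \<exists>t\<in>pverts T. u \<in> X t \<and> v \<in> X t"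
    "\<And>v. v \<in> U \<Longrightarrow> conn (parcs T) {t \<in> pverts T. v \<in> X t}"
    using td unfolding tree_decomposition_iff induced_def pair_pre_digraph.select_convs by blast+
  have leafT: "is_tree ?T" using is_tree_add_leaf[OF T(1) t(1) n] .
  have old: "?X s = X s" if "s \<in> pverts T" for s using that n by auto
  have NU: "N \<subseteq> U" using t T(2) by auto
  have verts: "pverts ?T = insert n (pverts T)" and arcs: "parcs ?T = parcs T \<union> {(n, t), (t, n)}"
    by (auto simp: add_leaf_def)
  have symT: "sym (parcs ?T)" using leafT by (auto simp: is_tree_iff simple_arcs_def)
  have "(\<Union>s\<in>pverts ?T. ?X s) = U \<union> S"
  proof -
    have "(\<Union>s\<in>pverts ?T. ?X s) = ?X n \<union> (\<Union>s\<in>pverts T. ?X s)" using verts by simp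
    also have "(\<Union>s\<in>pverts T. ?X s) = (\<Union>s\<in>pverts T. X s)" using old by (rule SUP_cong[OF refl])
    finally show ?thesis using T(2) NU by auto
  qed
  moreover have "\<exists>s\<in>pverts ?T. u \<in> ?X s \<and> v \<in> ?X s"
    if uv: "(u, v) \<in> parcs G" "u \<in> U \<union> S" "v \<in> U \<union> S" for u v
  proof (cases "u \<in> U \<and> v \<in> U")
    case True
    then obtain s where "s \<in> pverts T" "u \<in> X s" "v \<in> X s" using T(3)[OF uv(1)] by blast
    then show ?thesis using old verts by (intro bexI[of _ s]) auto
  next
    case False
    then have "u \<in> N \<union> S" "v \<in> N \<union> S"
      using uv(2,3) edges[OF _ _ uv(1)] edges[OF _ _ symD[OF G uv(1)]] by auto
    then show ?thesis using verts by (intro bexI[of _ n]) auto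
  qed
  moreover have "conn (parcs ?T) {s \<in> pverts ?T. v \<in> ?X s}" if "v \<in> U \<union> S" for v
  proof (cases "v \<in> U")
    case True
    have c: "conn (parcs ?T) {s \<in> pverts T. v \<in> X s}"
      using conn_mono[OF T(4)[OF True]] arcs by auto
    show ?thesis
    proof (cases "v \<in> N")
      case vN: True
      have "conn (parcs ?T) ({s \<in> pverts T. v \<in> X s} \<union> {n})"
        by (rule conn_Un_edge[OF symT c conn_singleton, of t]) (use t vN arcs in auto)
      moreover have "{s \<in> pverts ?T. v \<in> ?X s} = {s \<in> pverts T. v \<in> X s} \<union> {n}"
        using vN old verts n by auto
      ultimately show ?thesis by simp
    next
      case False
      then have "{s \<in> pverts ?T. v \<in> ?X s} = {s \<in> pverts T. v \<in> X s}"
        using old verts n True S by auto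
      then show ?thesis using c by simp
    qed
  next
    case False
    then have "{s \<in> pverts ?T. v \<in> ?X s} = {n}"
      using that old verts n T(2) by auto
    then show ?thesis by simp
  qed
  ultimately show ?thesis
    using leafT unfolding tree_decomposition_iff induced_def pair_pre_digraph.select_convs by blast
qed

text \<open>The decomposed part \<open>U\<close> grows by one leaf at a time. The invariant is that
  each component outside \<open>U\<close> is good and has its neighbourhood inside a single bag,
  where the next leaf can be attached.\<close>

lemma good_tree_decomposition:
  assumes G: "simple_arcs G" and "U \<subseteq> pverts G"
    and "tree_decomposition (induced G U) (T :: nat pair_pre_digraph) X"
    and "\<And>t. t \<in> pverts T \<Longrightarrow> card (X t) \<le> M"
    and "\<And>D. is_comp (parcs G) (pverts G - U) D \<Longrightarrow>
      good (parcs G) M D \<and> (\<exists>t\<in>pverts T. nbh (parcs G) D \<subseteq> X t)"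
  shows "\<exists>(T :: nat pair_pre_digraph) X. tree_decomposition G T X \<and> (\<forall>t\<in>pverts T. card (X t) \<le> M)"
  using assms(2-)
proof (induction "card (pverts G - U)" arbitrary: U T X rule: less_induct)
  case less
  let ?V = "pverts G" and ?E = "parcs G"
  have E: "finite ?V" "sym ?E" "?E \<subseteq> ?V \<times> ?V" using G by (auto simp: simple_arcs_def)
  show ?case
  proof (cases "U = ?V")
    case True
    have "Restr ?E ?V = ?E" using E(3) by auto
    then have "induced G U = G" using True by (simp add: induced_def)
    then show ?thesis using less.prems by auto
  next
    case False
    then obtain v where v: "v \<in> ?V - U" using less.prems(1) by blast
    then obtain D where D: "is_comp ?E (?V - U) D" using comp_exists[OF E(2)] by metis
    from less.prems(4)[OF D] obtain t where t: "t \<in> pverts T" "nbh ?E D \<subseteq> X t"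
      and gD: "good ?E M D" by blast
    from gD obtain S where S: "S \<subseteq> D" "S \<noteq> {}" "card (nbh ?E D \<union> S) \<le> M"
      "\<And>C. is_comp ?E (D - S) C \<Longrightarrow> good ?E M C" by (cases rule: good.cases) blast
    have DU: "D \<subseteq> ?V - U" using D by (auto simp: is_comp_def)
    have fT: "finite (pverts T)"
      using less.prems(2) by (auto simp: tree_decomposition_iff is_tree_iff simple_arcs_def)
    obtain n where n: "n \<notin> pverts T" using ex_new_if_finite[OF infinite_UNIV_nat fT] by blast
    let ?T = "add_leaf T t n" and ?X = "X(n := nbh ?E D \<union> S)"
    have td: "tree_decomposition (induced G (U \<union> S)) ?T ?X"
    proof (rule tree_decomposition_add_leaf[OF less.prems(2) t n E(2)])
      show "S \<inter> U = {}" using S DU by auto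
      fix s x assume "s \<in> S" "x \<in> U" "(s, x) \<in> ?E"
      then show "x \<in> nbh ?E D" using S(1) DU by (auto simp: nbh_def)
    qed
    have verts: "pverts ?T = insert n (pverts T)" by (simp add: add_leaf_def)
    show ?thesis
    proof (rule less.hyps[OF _ _ td])
      have "?V - (U \<union> S) \<subset> ?V - U" using S(1,2) DU by blast
      then show "card (?V - (U \<union> S)) < card (?V - U)" using E(1) by (simp add: psubset_card_mono)
      show "U \<union> S \<subseteq> ?V" using less.prems(1) S(1) DU by auto
      show "card (?X s) \<le> M" if "s \<in> pverts ?T" for s
        using that less.prems(3) S(3) verts by (auto simp: add_leaf_def)
      show "good ?E M C \<and> (\<exists>s\<in>pverts ?T. nbh ?E C \<subseteq> ?X s)"
        if C: "is_comp ?E (?V - (U \<union> S)) C" for C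
      proof -
        have C': "conn ?E C" "C \<subseteq> ?V - (U \<union> S)" "nbh ?E C \<inter> (?V - (U \<union> S)) = {}"
          using C by (auto simp: is_comp_def)
        show ?thesis
        \<comment> \<open>A component left after removing \<open>S\<close> is either an old one
          different from \<open>D\<close> or a component of \<open>D - S\<close>.\<close>
        proof (cases "C \<inter> D = {}")
          case True
          have "nbh ?E C \<inter> (?V - U) = {}"
          proof (rule ccontr)
            assume "\<not> ?thesis"
            then obtain x where x: "x \<in> nbh ?E C" "x \<in> ?V - U" by auto
            then have "x \<in> S" using C'(3) by auto
            obtain c where c: "c \<in> C" "(c, x) \<in> ?E" using x by (auto simp: nbh_def)
            have "c \<in> nbh ?E D" using symD[OF E(2) c(2)] \<open>x \<in> S\<close> S(1) True c(1)
              by (auto simp: nbh_def)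
            then show False using c(1) C'(2) D by (auto simp: is_comp_def)
          qed
          then have "is_comp ?E (?V - U) C" using C' by (auto simp: is_comp_def)
          from less.prems(4)[OF this] obtain s where "good ?E M C" "s \<in> pverts T" "nbh ?E C \<subseteq> X s"
            by blast
          then show ?thesis using verts n by (auto intro!: bexI[of _ s])
        next
          case False
          have "C \<subseteq> D" using conn_subset_comp[OF D C'(1)] C'(2) False by auto
          then have "is_comp ?E (D - S) C" using C' DU by (auto simp: is_comp_def)
          then show ?thesis using S(4) comp_nbh_Diff verts by fastforce
        qed
      qed
    qed
  qed
qed

section \<open>Cliques and tree-width\<close>

text \<open>As \<open>t\<close> is its only neighbour, \<open>{l}\<close> is a component of
  \<open>W - {t}\<close>, and \<open>conn_Diff_comp\<close> applies.\<close>

lemma conn_remove_leaf: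
  assumes "sym E" "conn E W" "t \<in> W" "l \<in> W" "l \<noteq> t" "\<And>x. x \<in> W \<Longrightarrow> (l, x) \<in> E \<Longrightarrow> x = t"
  shows "conn E (W - {l})"
proof (rule conn_Diff_comp[OF assms(1,2) conn_singleton, of t])
  show "is_comp E (W - {t}) {l}" using assms(4-6) by (auto simp: is_comp_def nbh_def)
qed (use assms(3) in auto)

text \<open>A longest path starts at a leaf: a further neighbour of its first vertex would either
  extend the path or close a cycle.\<close>

lemma tree_leaf:
  assumes "sym E" "irrefl E" "conn E W" "finite W" "\<And>vs. \<not> vcycle E vs" "2 \<le> card W"
  obtains l t where "l \<in> W" "t \<in> W" "l \<noteq> t" "\<And>x. x \<in> W \<Longrightarrow> (l, x) \<in> E \<Longrightarrow> x = t"
proof -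
  let ?P = "\<lambda>p. gpath E p \<and> set p \<subseteq> W"
  obtain w where w: "w \<in> W" using conn_nonempty[OF assms(3)] by auto
  then have "\<not> W \<subseteq> {w}" using assms(6) card_mono[of "{w}" W] by auto
  moreover have "W \<inter> {w} \<noteq> {}" using w by auto
  ultimately obtain u v where uv: "u \<in> W" "v \<in> W" "u = w" "v \<noteq> w" "(u, v) \<in> E"
    using conn_exit[OF assms(3), of "{w}"] by blast
  have P2: "?P [u, v]" using uv by (auto simp: gpath_def)
  have "length p < Suc (card W)" if "?P p" for p
  proof -
    have "length p = card (set p)" using that by (simp add: gpath_def distinct_card)
    also have "\<dots> \<le> card W" using that assms(4) by (simp add: card_mono)
    finally show ?thesis by simp
  qed
  then obtain p where p: "?P p" "\<And>q. ?P q \<Longrightarrow> length q \<le> length p"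
    using ex_has_greatest_nat[of ?P "[u, v]" length "Suc (card W)"] P2 by blast
  have "2 \<le> length p" using p(2)[OF P2] by simp
  then obtain l t r where ltr: "p = l # t # r" by (cases p rule: remdups_adj.cases) auto
  have "x = t" if x: "x \<in> W" "(l, x) \<in> E" for x
  proof (rule ccontr)
    assume "x \<noteq> t"
    have "(x, l) \<in> E" using x(2) assms(1) by (auto dest: symD)
    have "x \<in> set p"
    proof (rule ccontr)
      assume "x \<notin> set p"
      then have "?P (x # p)" using p(1) ltr x(1) \<open>(x, l) \<in> E\<close> by (auto simp: gpath_def)
      then show False using p(2) by fastforce
    qed
    moreover have "x \<noteq> l" using x(2) assms(2) by (auto simp: irrefl_def)
    ultimately have "x \<in> set r" using ltr \<open>x \<noteq> t\<close> by auto
    then obtain A B where AB: "r = A @ x # B" by (meson split_list)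
    define q where "q = l # t # A @ [x]"
    have "p = q @ B" "q \<noteq> []" "hd q = l" "last q = x" "3 \<le> length q"
      using ltr AB by (auto simp: q_def)
    then have "vcycle E q"
      using p(1) \<open>(x, l) \<in> E\<close> by (auto simp: gpath_def vcycle_def cyc_def successively_append_iff)
    then show False using assms(5) by blast
  qed
  moreover have "l \<in> W" "t \<in> W" "l \<noteq> t" using p(1) ltr by (auto simp: gpath_def)
  ultimately show thesis using that by blast
qed

text \<open>This is the Helly property of subtrees. Either some vertex of \<open>A\<close> occurs
  only at a leaf \<open>l\<close>, and then all of \<open>A\<close> meets it there, or all of
  \<open>A\<close> in the bag of \<open>l\<close> is also in the bag of its neighbour
  \<open>t\<close>, and \<open>l\<close> can be removed.\<close>

lemma clique_in_bag:
  assumes "sym E" "irrefl E" "\<And>vs. \<not> vcycle E vs"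
    and "finite W" "conn E W"
    and "\<And>v. v \<in> A \<Longrightarrow> conn E {t \<in> W. v \<in> X t}"
    and "\<And>u v. u \<in> A \<Longrightarrow> v \<in> A \<Longrightarrow> \<exists>t\<in>W. u \<in> X t \<and> v \<in> X t"
  shows "\<exists>t\<in>W. A \<subseteq> X t"
  using assms(4-)
proof (induction W rule: finite_psubset_induct)
  case (psubset W)
  show ?case
  proof (cases "2 \<le> card W")
    case False
    then have "card W = 1" using conn_nonempty[OF psubset.prems(1)] psubset.hyps(1)
      by (metis One_nat_def Suc_1 Suc_leI card_gt_0_iff le_neq_implies_less not_less_eq_eq)
    then obtain t where "W = {t}" by (auto simp: card_1_singleton_iff)
    then show ?thesis using psubset.prems(3) by fastforce
  next
    case True
    obtain l t where lt: "l \<in> W" "t \<in> W" "l \<noteq> t" "\<And>x. x \<in> W \<Longrightarrow> (l, x) \<in> E \<Longrightarrow> x = t"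
      using tree_leaf[OF assms(1,2) psubset.prems(1) psubset.hyps(1) assms(3) True] by blast
    show ?thesis
    proof (cases "\<exists>v\<in>A. {s \<in> W. v \<in> X s} \<subseteq> {l}")
      case True
      then obtain v where v: "v \<in> A" "{s \<in> W. v \<in> X s} \<subseteq> {l}" by blast
      have "u \<in> X l" if "u \<in> A" for u using psubset.prems(3)[OF that v(1)] v(2) by blast
      then show ?thesis using lt(1) by blast
    next
      case False
      have at: "v \<in> X t" if v: "v \<in> A" "v \<in> X l" for v
      proof -
        let ?B = "{s \<in> W. v \<in> X s}"
        have "\<not> ?B \<subseteq> {l}" "?B \<inter> {l} \<noteq> {}" using False v lt(1) by auto
        then obtain x where "x \<in> ?B" "(l, x) \<in> E"
          using conn_exit[OF psubset.prems(2)[OF v(1)], of "{l}"] by blast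
        then show ?thesis using lt(4) by blast
      qed
      have "\<exists>s\<in>W - {l}. A \<subseteq> X s"
      proof (rule psubset.IH)
        show "W - {l} \<subset> W" using lt(1) by auto
        show "conn E (W - {l})" using conn_remove_leaf[OF assms(1) psubset.prems(1) lt(2,1,3,4)] .
      next
        fix v assume v: "v \<in> A"
        show "conn E {s \<in> W - {l}. v \<in> X s}"
        proof (cases "v \<in> X l")
          case True
          have "conn E ({s \<in> W. v \<in> X s} - {l})"
            by (rule conn_remove_leaf[OF assms(1) psubset.prems(2)[OF v], of t])
              (use True at[OF v] lt in auto)
          moreover have "{s \<in> W. v \<in> X s} - {l} = {s \<in> W - {l}. v \<in> X s}" by auto
          ultimately show ?thesis by simp
        next
          case False
          then have "{s \<in> W - {l}. v \<in> X s} = {s \<in> W. v \<in> X s}" by auto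
          then show ?thesis using psubset.prems(2)[OF v] by simp
        qed
      next
        fix u v assume uv: "u \<in> A" "v \<in> A"
        obtain s where s: "s \<in> W" "u \<in> X s" "v \<in> X s" using psubset.prems(3)[OF uv] by blast
        show "\<exists>s\<in>W - {l}. u \<in> X s \<and> v \<in> X s"
        proof (cases "s = l")
          case True
          then show ?thesis using at uv s lt(2,3) by (intro bexI[of _ t]) auto
        qed (use s in blast)
      qed
      then show ?thesis by blast
    qed
  qed
qed

text \<open>The integers are not well-ordered, so the lower bound \<open>b\<close> is used to shift
  the problem to natural numbers.\<close>

lemma int_Least:
  fixes P :: "int \<Rightarrow> bool"
  assumes "P w" "\<And>x. P x \<Longrightarrow> b \<le> x"
  shows "P (LEAST x. P x)" "(LEAST x. P x) \<le> w"
proof -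
  obtain x where x: "P x" "\<And>y. P y \<Longrightarrow> nat (x - b) \<le> nat (y - b)"
    using ex_has_least_nat[of P w "\<lambda>x. nat (x - b)"] assms(1) by blast
  have le: "x \<le> y" if "P y" for y
    using x(2)[OF that] assms(2)[OF x(1)] assms(2)[OF that] by linarith
  have "(LEAST x. P x) = x" using x(1) le by (rule Least_equality)
  then show "P (LEAST x. P x)" "(LEAST x. P x) \<le> w" using x(1) le[OF assms(1)] by auto
qed

section \<open>Bounds on width, and tree-width as an attained minimum\<close>

lemma tree_decomposition_tree:
  assumes "tree_decomposition G T X"
  shows "finite (pverts T)" "pverts T \<noteq> {}"
  using assms by (auto simp: tree_decomposition_iff is_tree_iff simple_arcs_def conn_def)

lemma width_ge_bag:
  assumes "finite (pverts T)" "t \<in> pverts T"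
  shows "int (card (X t)) - 1 \<le> width T X"
proof -
  have "int (card (X t)) \<le> Max ((\<lambda>t. int (card (X t))) ` pverts T)"
    using assms by (intro Max_ge) auto
  then show ?thesis unfolding width_def by linarith
qed

lemma width_lower:
  assumes "tree_decomposition G T X"
  shows "-1 \<le> width T X"
proof -
  obtain t where "t \<in> pverts T" using tree_decomposition_tree(2)[OF assms] by auto
  then show ?thesis using width_ge_bag[OF tree_decomposition_tree(1)[OF assms], of t X] by linarith
qed

lemma treewidth_le:
  fixes T :: "nat pair_pre_digraph"
  assumes "tree_decomposition G T X" "\<And>t. t \<in> pverts T \<Longrightarrow> card (X t) \<le> M"
  shows "treewidth G \<le> int M - 1"
proof -
  have "width T X \<le> int M - 1"
  proof -
    have "Max ((\<lambda>t. int (card (X t))) ` pverts T) \<le> int M"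
      using tree_decomposition_tree[OF assms(1)] assms(2) by (subst Max_le_iff) auto
    then show ?thesis by (simp add: width_def)
  qed
  moreover have "treewidth G \<le> width T X"
    unfolding treewidth_def
    by (rule int_Least(2)[where b = "-1"]) (use assms(1) width_lower in blast)+
  ultimately show ?thesis by simp
qed

lemma treewidth_attained:
  fixes T :: "nat pair_pre_digraph"
  assumes "tree_decomposition G T X"
  shows "\<exists>(T :: nat pair_pre_digraph) X. tree_decomposition G T X \<and> width T X = treewidth G"
  unfolding treewidth_def
  by (rule int_Least(1)[where b = "-1"]) (use assms width_lower in blast)+

lemma single_bag_tree: "is_tree \<lparr> pverts = {t}, parcs = {} \<rparr>"
proof -
  have "\<not> vcycle {} vs" for vs :: "'a list"
    by (cases vs) (auto simp: vcycle_def cyc_def successively_Cons)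
  then show ?thesis by (auto simp: is_tree_iff simple_arcs_def irrefl_def sym_def)
qed

lemma tree_decomposition_single_bag:
  assumes "parcs G \<subseteq> pverts G \<times> pverts G"
  shows "tree_decomposition G \<lparr> pverts = {t}, parcs = {} \<rparr> (\<lambda>_. pverts G)"
  using assms single_bag_tree by (auto simp: tree_decomposition_iff)

section \<open>The complete graph as the extremal example\<close>

definition complete_graph :: "nat \<Rightarrow> nat pair_pre_digraph" where
  "complete_graph k = \<lparr> pverts = {..<k}, parcs = {(i, j). i < k \<and> j < k \<and> i \<noteq> j} \<rparr>"

lemma pair_graph_complete: "pair_graph (complete_graph k)"
  unfolding pair_graph_iff
  by (auto simp: complete_graph_def simple_arcs_def irrefl_def sym_def)

lemma treewidth_complete: "int k - 1 \<le> treewidth (complete_graph k)"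
proof -
  let ?G = "complete_graph k"
  have "int k - 1 \<le> width T X" if td: "tree_decomposition ?G (T :: nat pair_pre_digraph) X" for T X
  proof -
    have T: "simple_arcs T" "irrefl (parcs T)" "conn (parcs T) (pverts T)"
        "\<And>vs. \<not> vcycle (parcs T) vs"
      and cover: "(\<Union>t\<in>pverts T. X t) = pverts ?G"
      and edge: "\<And>u v. (u, v) \<in> parcs ?G \<Longrightarrow> \<exists>t\<in>pverts T. u \<in> X t \<and> v \<in> X t"
      and sub: "\<And>v. v \<in> pverts ?G \<Longrightarrow> conn (parcs T) {t \<in> pverts T. v \<in> X t}"
      using td unfolding tree_decomposition_iff is_tree_iff by blast+
    have "\<exists>t\<in>pverts T. pverts ?G \<subseteq> X t"
    proof (rule clique_in_bag[OF _ T(2,4) _ T(3) sub])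
      fix u v assume uv: "u \<in> pverts ?G" "v \<in> pverts ?G"
      show "\<exists>t\<in>pverts T. u \<in> X t \<and> v \<in> X t"
      proof (cases "u = v")
        case True
        then show ?thesis using uv cover by blast
      next
        case False
        then show ?thesis using uv by (intro edge) (auto simp: complete_graph_def)
      qed
    qed (use T(1) in \<open>auto simp: simple_arcs_def\<close>)
    then obtain t where t: "t \<in> pverts T" "pverts ?G \<subseteq> X t" by blast
    have "X t = pverts ?G" using t cover by blast
    then have "card (X t) = k" by (simp add: complete_graph_def)
    then show ?thesis using width_ge_bag[OF tree_decomposition_tree(1)[OF td] t(1), of X] by simp
  qed
  moreover have "tree_decomposition ?G \<lparr> pverts = {0 :: nat}, parcs = {} \<rparr> (\<lambda>_. pverts ?G)"
    by (rule tree_decomposition_single_bag) (auto simp: complete_graph_def)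
  ultimately show ?thesis using treewidth_attained by metis
qed

lemma minor_step_card:
  assumes "minor_step G G'" "finite (pverts G)"
  shows "finite (pverts G')" "card (pverts G') \<le> card (pverts G)"
  using assms by (induction rule: minor_step.induct) (auto intro: card_mono)

lemma has_minor_card:
  assumes "has_minor G H" "finite (pverts G)"
  shows "card (pverts H) \<le> card (pverts G)"
proof -
  obtain K where K: "minor_step\<^sup>*\<^sup>* G K" "digraph_iso (with_proj K) (with_proj H)"
    using assms(1) by (auto simp: has_minor_def)
  have "finite (pverts K) \<and> card (pverts K) \<le> card (pverts G)"
    using K(1)
  proof (induction rule: rtranclp_induct)
    case (step y z)
    then show ?case using minor_step_card[OF step(2)] by fastforce
  qed (use assms(2) in simp)
  then show ?thesis using digraph_iso_card_verts[OF K(2)] by simp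
qed

section \<open>The bounds\<close>

text \<open>Without the minor, start from one empty bag. Each component of \<open>G\<close> has no
  neighbours and carries the empty state, so it is good by \<open>state_good\<close>, and the
  resulting decomposition has width at most \<open>M - 1\<close>.\<close>

lemma wheel_minor_of_treewidth:
  assumes G: "pair_graph G" and k: "3 \<le> k" "k \<le> M" "3 * k \<le> 2 * M + 7"
    and tw: "int M \<le> treewidth G"
  shows "has_minor G (wheel_graph k)"
proof (rule ccontr)
  assume no: "\<not> ?thesis"
  let ?E = "parcs G" and ?V = "pverts G"
  have SG: "simple_arcs G" using G by (simp add: pair_graph_iff)
  then have E: "finite ?V" "sym ?E" "?E \<subseteq> ?V \<times> ?V" by (auto simp: simple_arcs_def)
  have small: "length ys < k" if "state ?E I ys g" "I \<subseteq> ?V" for I ys g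
    using state_wheel_minor[OF SG that k(1)] no by force
  have "tree_decomposition (induced G {}) \<lparr> pverts = {0 :: nat}, parcs = {} \<rparr> (\<lambda>_. {})"
    using tree_decomposition_single_bag[of "induced G {}"] by (simp add: induced_def)
  moreover have "good ?E M D \<and> nbh ?E D \<subseteq> {}" if D: "is_comp ?E (?V - {}) D" for D
  proof -
    have N: "nbh ?E D = {}" using D E(3) by (auto simp: is_comp_def nbh_def)
    then have "state ?E D [] (\<lambda>_. {})"
      using is_comp_conn[OF D] by (auto simp: state_def weak_state_def cyc_def)
    then show ?thesis
      using state_good[OF E(2,1,3) k(2,3) small] N is_comp_subset[OF D] by auto
  qed
  ultimately obtain T :: "nat pair_pre_digraph" and X
    where "tree_decomposition G T X" "\<forall>t\<in>pverts T. card (X t) \<le> M"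
    using good_tree_decomposition[OF SG, of "{}" "\<lparr> pverts = {0 :: nat}, parcs = {} \<rparr>" "\<lambda>_. {}" M] by auto
  then show False using treewidth_le[of G T X M] tw by auto
qed

theorem theorem1p2:
  fixes H :: "'b pair_pre_digraph"
  assumes "is_wheel H"
  shows "(\<forall>G :: 'a pair_pre_digraph. pair_graph G \<and>
            real_of_int (treewidth G)
              \<ge> max (3 / 2 * real (card (pverts H)) - 9 / 2) (real (card (pverts H)) - 1)
            \<longrightarrow> has_minor G H) \<and>
         real_of_int (minor_threshold H)
           \<le> max (3 / 2 * real (card (pverts H)) - 9 / 2) (real (card (pverts H)) - 1) \<and>
         (card (pverts H) \<le> 7 \<longrightarrow> minor_threshold H = int (card (pverts H)) - 1)"
proof -
  obtain k where k: "3 \<le> k" and iso: "digraph_iso (with_proj (wheel_graph k)) (with_proj H)"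
    using assms by (auto simp: is_wheel_def)
  have card: "card (pverts H) = k + 1"
    using digraph_iso_card_verts[OF iso] by (simp add: wheel_verts)
  \<comment> \<open>The second argument is the integer part of \<open>3 * k / 2 - 3\<close>; the
    subtraction is exact because \<open>3 \<le> k\<close>.\<close>
  define M where "M = max k ((3 * k - 6) div 2)"
  have M: "k \<le> M" "3 * k \<le> 2 * M + 7" by (auto simp: M_def)
  have bound: "max (3 / 2 * real (card (pverts H)) - 9 / 2) (real (card (pverts H)) - 1)
      = max ((3 * real k - 6) / 2) (real k)"
  proof -
    have "3 / 2 * real (k + 1) - 9 / 2 = (3 * real k - 6) / 2" by (simp add: field_split_simps)
    moreover have "real (k + 1) - 1 = real k" by simp
    ultimately show ?thesis unfolding card by (simp only:)
  qed
  have "2 * ((3 * k - 6) div 2) \<le> 3 * k - 6" by simp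
  then have "2 * real ((3 * k - 6) div 2) \<le> 3 * real k - 6" using k by linarith
  then have "real M \<le> max ((3 * real k - 6) / 2) (real k)"
    unfolding M_def by (auto simp: max_def)
  then have MB: "real M \<le> max (3 / 2 * real (card (pverts H)) - 9 / 2) (real (card (pverts H)) - 1)"
    unfolding bound .
  \<comment> \<open>The fresh type \<open>'c\<close> allows use both for graphs over
    \<open>'a\<close> and for graphs over \<open>nat\<close>, over which the threshold is
    defined.\<close>
  have minor: "has_minor G H" if "pair_graph G" "int M \<le> treewidth G" for G :: "'c pair_pre_digraph"
    using wheel_minor_of_treewidth[OF that(1) k M that(2)] digraph_iso_trans[OF _ iso]
    unfolding has_minor_def by blast
  have part1: "has_minor G H"
    if "pair_graph G" "real_of_int (treewidth G)
      \<ge> max (3 / 2 * real (card (pverts H)) - 9 / 2) (real (card (pverts H)) - 1)"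
    for G :: "'a pair_pre_digraph"
  proof (rule minor[OF that(1)])
    have "real M \<le> real_of_int (treewidth G)" using MB that(2) by linarith
    then show "int M \<le> treewidth G" by linarith
  qed
  let ?P = "\<lambda>n. \<forall>G :: nat pair_pre_digraph. pair_graph G \<and> n \<le> treewidth G \<longrightarrow> has_minor G H"
  have PM: "?P (int M)" using minor by blast
  \<comment> \<open>If \<open>n < k\<close>, the complete graph on \<open>k\<close> vertices would
    qualify, but it has fewer vertices than \<open>H\<close>.\<close>
  have lower: "int k \<le> n" if "?P n" for n
  proof (rule ccontr)
    assume "\<not> int k \<le> n"
    then have "has_minor (complete_graph k) H"
      using that pair_graph_complete[of k] treewidth_complete[of k] by auto
    then have "card (pverts H) \<le> card (pverts (complete_graph k))"
      by (rule has_minor_card) (simp add: complete_graph_def)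
    then show False by (simp add: complete_graph_def card)
  qed
  have thr: "minor_threshold H \<le> int M" "int k \<le> minor_threshold H"
    unfolding minor_threshold_def
    using int_Least[of ?P "int M" "int k", OF PM lower] lower by blast+
  have "real_of_int (minor_threshold H) \<le> real M" using thr(1) by linarith
  \<comment> \<open>Here \<open>k \<le> 6\<close>, where \<open>(3 * k - 6) div 2\<close> does not
    exceed \<open>k\<close>, so the two bounds meet.\<close>
  moreover have "M = k" if "card (pverts H) \<le> 7"
    using that unfolding card M_def by auto
  ultimately show ?thesis using part1 thr MB card by auto
qed

end
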